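(* Let $r\ge 2$. For every $n\in\mathbb{N}$ let $\mathcal{H}_n$ be a finite-dimensional Hilbert space and let $A_{1,n},\ldots,A_{r,n}$ be non-zero positive semidefinite operators on $\mathcal{H}_n$. Write $\vec{A}_i:=\{A_{i,n}\}_{n\in\mathbb{N}}$ and $A_{0,n}:=\sum_{i=1}^r A_{i,n}$. Assume that $\limsup_{n\to\infty}\frac1n\log\operatorname{Tr}A_{0,n}=0$. Then for any pair $(k,l)$ with $k\ne l$, $$\overline{p}_e(\vec{A}_1,\ldots,\vec{A}_r)\le\max\Big(\{\overline{p}_e(\vec{A}_k,\vec{A}_l)\}\cup\{\tfrac12\overline{p}_e(\vec{A}_i,\vec{A}_j):\,i\ne j,\ \{i,j\}\ne\{k,l\}\}\Big)$$ $$\le-\min\Big(\{C(\vec{A}_k,\vec{A}_l)\}\cup\{\tfrac12C(\vec{A}_i,\vec{A}_j):\,i\ne j,\ \{i,j\}\ne\{k,l\}\}\Big).$$ In particular, if there exists a pair $(k,l)$, $k\ne l$, such that either $\overline{p}_e(\vec{A}_k,\vec{A}_l)\ge\frac12\overline{p}_e(\vec{A}_i,\vec{A}_j)$ for all $i\ne j$ with $\{i,j\}\ne\{k,l\}$, or $C(\vec{A}_k,\vec{A}_l)\le\frac12C(\vec{A}_i,\vec{A}_j)$ for all $i\ne j$ with $\{i,j\}\ne\{k,l\}$, then $$\overline{p}_e(\vec{A}_1,\ldots,\vec{A}_r)\le\max_{(i,j):\,i\ne j}\overline{p}_e(\vec{A}_i,\vec{A}_j)\le-\min_{(i,j):\,i\ne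 j}C(\vec{A}_i,\vec{A}_j).$$
   Context: A POVM $\{E_1,\ldots,E_m\}$ on a finite-dimensional Hilbert space is a family of positive semidefinite operators with $E_1+\cdots+E_m\le I$. For positive semidefinite $A_1,\ldots,A_m$, the optimal error is $P_e^*(A_1,\ldots,A_m):=\min\{\sum_{i=1}^m\operatorname{Tr}A_i(I-E_i):\{E_1,\ldots,E_m\}\text{ POVM}\}$. The logarithm has a fixed base larger than $1$, with $\log 0:=-\infty$ and $\log(+\infty):=+\infty$. For sequences $\vec{A}_i=\{A_{i,n}\}_{n}$ of positive semidefinite operators with $A_{1,n},\ldots,A_{m,n}$ acting on the same space for each $n$, $\overline{p}_e(\vec{A}_1,\ldots,\vec{A}_m):=\limsup_{n\to\infty}\frac1n\log P_e^*(A_{1,n},\ldots,A_{m,n})$. Powers of a positive semidefinite operator are taken only on its support (so $A^0$ is the projection onto the support of $A$). The regularized Chernoff divergence of two sequences is $C(\vec{A}_i,\vec{A}_j):=-\limsup_{n\to\infty}\frac1n\log\min_{0\le s\le1}\operatorname{Tr}A_{i,n}^sA_{j,n}^{1-s}$. *)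

theory Defs
  imports
    Complex_Main
    "HOL-Library.Extended_Real"
    "HOL-Library.Liminf_Limsup"
    "Jordan_Normal_Form.Schur_Decomposition"
begin

text \<open>
  A Hilbert space of finite dimension \<open>d\<close> is represented by \<open>carrier_vec d\<close> over the complex
  numbers, and operators on it by \<open>carrier_mat d d\<close>.
\<close>

definition mat_trace :: "complex mat \<Rightarrow> complex" where
  "mat_trace A = (\<Sum>i<dim_row A. A $$ (i, i))"

definition mat_sum :: "nat \<Rightarrow> 'i set \<Rightarrow> ('i \<Rightarrow> complex mat) \<Rightarrow> complex mat" where
  "mat_sum d I F = mat d d (\<lambda>(a, b). \<Sum>i\<in>I. F i $$ (a, b))"

text \<open>
  The order on complex numbers is that of \<open>HOL-Library.Complex_Order\<close>, so \<open>0 \<le> z\<close> says that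
  \<open>z\<close> is real and nonnegative; in particular positive semidefinite matrices are Hermitian.
\<close>

definition psd :: "nat \<Rightarrow> complex mat \<Rightarrow> bool" where
  "psd d A \<longleftrightarrow> A \<in> carrier_mat d d \<and> (\<forall>v\<in>carrier_vec d. 0 \<le> (A *\<^sub>v v) \<bullet>c v)"

text \<open>The elements of a POVM only have to sum to at most the identity.\<close>

definition povm :: "nat \<Rightarrow> nat \<Rightarrow> (nat \<Rightarrow> complex mat) \<Rightarrow> bool" where
  "povm d m E \<longleftrightarrow> (\<forall>i<m. psd d (E i)) \<and> psd d (1\<^sub>m d - mat_sum d {..<m} E)"

text \<open>The infimum is a minimum, because the set of POVMs is compact and nonempty.\<close>

definition opt_err :: "nat \<Rightarrow> complex mat list \<Rightarrow> real" where
  "opt_err d As =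
     Inf {(\<Sum>i<length As. Re (mat_trace (As ! i * (1\<^sub>m d - E i)))) | E. povm d (length As) E}"

definition unitary_mat :: "nat \<Rightarrow> complex mat \<Rightarrow> bool" where
  "unitary_mat d U \<longleftrightarrow>
     U \<in> carrier_mat d d \<and> U * mat_adjoint U = 1\<^sub>m d \<and> mat_adjoint U * U = 1\<^sub>m d"

text \<open>
  Powers on the support, through a spectral decomposition; the result does not depend on the
  decomposition (\<open>psd_powr_eqI\<close>). Since \<open>0 powr s = 0\<close> for every \<open>s\<close>, including \<open>s = 0\<close>, only the
  nonzero eigenvalues contribute, and the zeroth power is the projection onto the support.
\<close>

definition psd_powr :: "nat \<Rightarrow> complex mat \<Rightarrow> real \<Rightarrow> complex mat" where
  "psd_powr d A s = (THE B. \<exists>U e. unitary_mat d U \<and>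
     A = U * mat_diag d (\<lambda>i. complex_of_real (e i)) * mat_adjoint U \<and>
     B = U * mat_diag d (\<lambda>i. complex_of_real (e i powr s)) * mat_adjoint U)"

lemma mat_adjoint_carrier: "U \<in> carrier_mat n m \<Longrightarrow> mat_adjoint U \<in> carrier_mat m n"
  by (auto simp: mat_adjoint_def)

lemma spectral_calculus_unique:
  fixes g :: "real \<Rightarrow> real"
  assumes U: "unitary_mat d U" and V: "unitary_mat d V"
    and eq: "U * mat_diag d (\<lambda>i. complex_of_real (e i)) * mat_adjoint U
           = V * mat_diag d (\<lambda>i. complex_of_real (f i)) * mat_adjoint V"
  shows "U * mat_diag d (\<lambda>i. complex_of_real (g (e i))) * mat_adjoint U
       = V * mat_diag d (\<lambda>i. complex_of_real (g (f i))) * mat_adjoint V"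
proof -
  define U' where "U' = mat_adjoint U"
  define V' where "V' = mat_adjoint V"
  define D where "D h = mat_diag d (\<lambda>i. complex_of_real (h (e i)))" for h :: "real \<Rightarrow> real"
  define F where "F h = mat_diag d (\<lambda>i. complex_of_real (h (f i)))" for h :: "real \<Rightarrow> real"
  have c: "U \<in> carrier_mat d d" "V \<in> carrier_mat d d" "U' \<in> carrier_mat d d" "V' \<in> carrier_mat d d"
    "\<And>h. D h \<in> carrier_mat d d" "\<And>h. F h \<in> carrier_mat d d"
    using U V by (auto simp: unitary_mat_def U'_def V'_def D_def F_def intro: mat_adjoint_carrier)
  have UU: "U * U' = 1\<^sub>m d" "U' * U = 1\<^sub>m d" and VV: "V * V' = 1\<^sub>m d" "V' * V = 1\<^sub>m d"
    using U V by (auto simp: unitary_mat_def U'_def V'_def)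
  note assoc = assoc_mult_mat[of _ d d _ d _ d] and mc = mult_carrier_mat[of _ d d _ d]
    and one = left_mult_one_mat[of _ d d] right_mult_one_mat[of _ d d]
  define W where "W = V' * U"
  have W: "W \<in> carrier_mat d d" using c by (auto simp: W_def)
  have eq': "U * D id * U' = V * F id * V'"
    using eq by (simp add: U'_def V'_def D_def F_def)
  have "W * D id = V' * (U * D id * U') * U"
  proof -
    have "V' * (U * D id * U') * U = V' * (U * D id * (U' * U))"
      using c by (simp add: assoc mc)
    also have "\<dots> = W * D id"
      using c by (simp add: UU W_def assoc mc one)
    finally show ?thesis by simp
  qed
  also have "\<dots> = V' * (V * F id * V') * U" by (simp only: eq')
  also have "\<dots> = (V' * V) * F id * W"
    using c by (simp add: W_def assoc mc)
  also have "\<dots> = F id * W" using c W by (simp add: VV mc one)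
  finally have com: "W * D id = F id * W" .
  have com': "W * D g = F g * W"
  proof (rule eq_matI)
    fix i j assume "i < dim_row (F g * W)" "j < dim_col (F g * W)"
    hence ij: "i < d" "j < d" using W c(6)[of g] by auto
    have "(W * D id) $$ (i, j) = (F id * W) $$ (i, j)" by (simp only: com)
    hence *: "W $$ (i, j) * complex_of_real (e j) = complex_of_real (f i) * W $$ (i, j)"
      using ij by (simp add: D_def F_def mat_diag_mult_left[OF W] mat_diag_mult_right[OF W])
    have "W $$ (i, j) * complex_of_real (g (e j)) = complex_of_real (g (f i)) * W $$ (i, j)"
    proof (cases "W $$ (i, j) = 0")
      case False
      with * have "complex_of_real (e j) = complex_of_real (f i)" by (simp add: mult.commute)
      hence "e j = f i" by simp
      thus ?thesis by simp
    qed simp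
    thus "(W * D g) $$ (i, j) = (F g * W) $$ (i, j)"
      using ij by (simp add: D_def F_def mat_diag_mult_left[OF W] mat_diag_mult_right[OF W])
  qed (use W c(5)[of g] c(6)[of g] in auto)
  have VW: "V * W = U"
    using c by (simp add: W_def VV mc one flip: assoc)
  have "U * D g * U' = V * (W * D g) * U'"
    using c W by (simp add: assoc mc flip: VW)
  also have "\<dots> = V * (F g * W) * U'" by (simp only: com')
  also have "\<dots> = V * F g * (V' * (U * U'))"
    using c by (simp add: W_def assoc mc)
  also have "\<dots> = V * F g * V'" using c by (simp add: UU mc one)
  finally show ?thesis by (simp add: U'_def V'_def D_def F_def)
qed

lemma psd_powr_eqI:
  assumes "unitary_mat d U"
    and "A = U * mat_diag d (\<lambda>i. complex_of_real (e i)) * mat_adjoint U"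
  shows "psd_powr d A s = U * mat_diag d (\<lambda>i. complex_of_real (e i powr s)) * mat_adjoint U"
  unfolding psd_powr_def
proof (rule the_equality)
  show "\<exists>U' e'. unitary_mat d U' \<and>
     A = U' * mat_diag d (\<lambda>i. complex_of_real (e' i)) * mat_adjoint U' \<and>
     U * mat_diag d (\<lambda>i. complex_of_real (e i powr s)) * mat_adjoint U =
     U' * mat_diag d (\<lambda>i. complex_of_real (e' i powr s)) * mat_adjoint U'"
    using assms by blast
next
  fix B assume "\<exists>U' e'. unitary_mat d U' \<and>
     A = U' * mat_diag d (\<lambda>i. complex_of_real (e' i)) * mat_adjoint U' \<and>
     B = U' * mat_diag d (\<lambda>i. complex_of_real (e' i powr s)) * mat_adjoint U'"
  then obtain V f where V: "unitary_mat d V"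
    and A: "A = V * mat_diag d (\<lambda>i. complex_of_real (f i)) * mat_adjoint V"
    and B: "B = V * mat_diag d (\<lambda>i. complex_of_real (f i powr s)) * mat_adjoint V" by blast
  show "B = U * mat_diag d (\<lambda>i. complex_of_real (e i powr s)) * mat_adjoint U"
    unfolding B
    using spectral_calculus_unique[OF V assms(1), of f e "\<lambda>x. x powr s"] A assms(2) by simp
qed

text \<open>
  The logarithm is only applied to nonnegative finite quantities; \<open>log 0 = -\<infinity>\<close>.
\<close>

definition elog :: "real \<Rightarrow> real \<Rightarrow> ereal" where
  "elog b x = (if x \<le> 0 then -\<infinity> else ereal (log b x))"

definition exp_rate :: "real \<Rightarrow> (nat \<Rightarrow> real) \<Rightarrow> ereal" where
  "exp_rate b x = limsup (\<lambda>n. ereal (1 / real n) * elog b (x n))"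

definition err_exponent :: "real \<Rightarrow> (nat \<Rightarrow> nat) \<Rightarrow> (nat \<Rightarrow> complex mat) list \<Rightarrow> ereal" where
  "err_exponent b d As = exp_rate b (\<lambda>n. opt_err (d n) (map (\<lambda>X. X n) As))"

text \<open>
  The trace of a product of two positive semidefinite matrices is real. The infimum over \<open>s\<close> is a
  minimum: with powers taken on the supports the trace is continuous on the closed unit interval.
\<close>

definition chernoff ::
    "real \<Rightarrow> (nat \<Rightarrow> nat) \<Rightarrow> (nat \<Rightarrow> complex mat) \<Rightarrow> (nat \<Rightarrow> complex mat) \<Rightarrow> ereal" where
  "chernoff b d X Y = - exp_rate b (\<lambda>n.
     INF s\<in>{0..1}. Re (mat_trace (psd_powr (d n) (X n) s * psd_powr (d n) (Y n) (1 - s))))"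

end

theory Submission
  imports Defs "Jordan_Normal_Form.Spectral_Radius"
begin

text \<open>
  Let \<open>\<lambda>\<^sub>k, x\<^sub>k\<close> and \<open>\<mu>\<^sub>l, y\<^sub>l\<close> be eigensystems of two positive semidefinite operators \<open>X\<close> and \<open>Y\<close>, and
  put \<open>N(X, Y) = \<Sum>k l. min \<lambda>\<^sub>k \<mu>\<^sub>l |\<langle>x\<^sub>k, y\<^sub>l\<rangle>|\<^sup>2\<close>. Then \<open>N(X, Y)\<close> is at most twice the optimal
  error (Nussbaum-Szkola) and at most \<open>Tr X\<^sup>s Y\<^sup>1\<^sup>-\<^sup>s\<close>. Conversely, the optimal error of \<open>r\<close> hypotheses
  is at most \<open>4 (r + 1)\<close> times the sum of \<open>N(A\<^sub>i, A\<^sub>j)\<close> over all \<open>i \<noteq> j\<close>, in every dimension. For this, round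
  the eigenvalues to powers of two, run through the eigenspaces of all hypotheses by decreasing level,
  and give to each hypothesis the directions its eigenspace adds to the span of the previous ones.
  The error at a level of weight \<open>w\<close> is the overlap of an eigenspace \<open>Q\<close> with a join \<open>U\<close> of projections
  with sum \<open>M\<close>. Since \<open>U M = M\<close>, we have \<open>U = 2 M - M\<^sup>2 + (U - M)\<^sup>2\<close> and
  \<open>Tr (U - M)\<^sup>2 \<le> Tr (M\<^sup>2 - M)\<close>, so that \<open>Tr Q U\<close> is bounded by pairwise overlaps; the weights \<open>w\<close> of
  the terms \<open>Tr (M\<^sup>2 - M)\<close> add up geometrically.

  Hence the exponent for \<open>r\<close> hypotheses is at most the largest pairwise exponent, without any factor
  one half. The pairwise exponents are nonpositive by the trace condition, and so all the
  inequalities follow.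
\<close>

section \<open>Orthonormal sets\<close>

text \<open>A vector of dimension \<open>d\<close> is a function on the natural numbers of which only the values below
  \<open>d\<close> matter.\<close>

definition ip :: "nat \<Rightarrow> (nat \<Rightarrow> complex) \<Rightarrow> (nat \<Rightarrow> complex) \<Rightarrow> complex" where
  "ip d x y = (\<Sum>a<d. x a * cnj (y a))"

section \<open>Sesquilinear calculus of the inner product\<close>

lemma ip_cong: "(\<And>a. a < d \<Longrightarrow> x a = x' a) \<Longrightarrow> (\<And>a. a < d \<Longrightarrow> y a = y' a) \<Longrightarrow> ip d x y = ip d x' y'"
  by (auto simp: ip_def)

lemma cnj_ip: "cnj (ip d x y) = ip d y x"
  by (simp add: ip_def mult.commute)

lemma cmod_ip_commute: "cmod (ip d x y) = cmod (ip d y x)"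
  by (metis cnj_ip complex_mod_cnj)

lemma ip_mult_commute: "ip d x y * ip d y x = complex_of_real ((cmod (ip d x y))\<^sup>2)"
  by (metis cnj_ip complex_norm_square)

lemma ip_diff_left: "ip d (\<lambda>a. x a - y a) z = ip d x z - ip d y z"
  by (simp add: ip_def algebra_simps sum_subtractf)

lemma ip_diff_right: "ip d x (\<lambda>a. y a - z a) = ip d x y - ip d x z"
  by (simp add: ip_def algebra_simps sum_subtractf)

lemma ip_scale_left: "ip d (\<lambda>a. c * x a) z = c * ip d x z"
  by (simp add: ip_def sum_distrib_left mult.assoc)

lemma ip_scale_right: "ip d z (\<lambda>a. c * x a) = cnj c * ip d z x"
  by (simp add: ip_def sum_distrib_left algebra_simps)

lemma ip_sum_left: "ip d (\<lambda>a. \<Sum>i\<in>I. c i * u i a) y = (\<Sum>i\<in>I. c i * ip d (u i) y)"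
  unfolding ip_def sum_distrib_left sum_distrib_right mult.assoc by (rule sum.swap)

lemma ip_sum_right: "ip d x (\<lambda>a. \<Sum>i\<in>I. c i * u i a) = (\<Sum>i\<in>I. cnj (c i) * ip d x (u i))"
proof -
  have "ip d x (\<lambda>a. \<Sum>i\<in>I. c i * u i a) = cnj (ip d (\<lambda>a. \<Sum>i\<in>I. c i * u i a) x)"
    by (simp add: cnj_ip)
  then show ?thesis by (simp add: ip_sum_left cnj_ip)
qed

text \<open>With \<open>M = \<Sum>i. |y i><y i|\<close>, both sides are \<open><v, M^2 v>\<close>,
  the left one as the squared norm of \<open>M v\<close>.\<close>

lemma ip_frame:
  "ip d (\<lambda>a. \<Sum>i\<in>I. ip d v (y i) * y i a) (\<lambda>a. \<Sum>i\<in>I. ip d v (y i) * y i a)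
     = (\<Sum>i\<in>I. \<Sum>j\<in>I. ip d v (y i) * ip d (y i) (y j) * ip d (y j) v)"
  unfolding ip_sum_left ip_sum_right by (simp add: sum_distrib_left cnj_ip mult_ac)

lemma ip_self: "ip d x x = complex_of_real (\<Sum>a<d. (cmod (x a))\<^sup>2)"
  unfolding ip_def of_real_sum by (intro sum.cong refl) (metis complex_norm_square)

lemma ip_self_nonneg: "0 \<le> Re (ip d x x)"
  by (simp add: ip_self sum_nonneg)

lemma ip_self_Re: "ip d x x = complex_of_real (Re (ip d x x))"
  by (simp add: ip_self)

lemma ip_self_eq_0D: "ip d x x = 0 \<Longrightarrow> a < d \<Longrightarrow> x a = 0"
proof -
  assume "ip d x x = 0" and a: "a < d"
  then have "(\<Sum>a<d. (cmod (x a))\<^sup>2) = 0" unfolding ip_self by (simp only: of_real_eq_0_iff)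
  then have "(cmod (x a))\<^sup>2 = 0" using a by (subst (asm) sum_nonneg_eq_0_iff) auto
  then show "x a = 0" by simp
qed

lemma ip_self_square:
  assumes "ip d x x \<noteq> 0"
  shows "\<exists>n>0. ip d x x = complex_of_real (n\<^sup>2)"
proof -
  have "Re (ip d x x) \<noteq> 0" using assms ip_self_Re[of d x] by auto
  then have "0 < Re (ip d x x)" using ip_self_nonneg[of d x] by simp
  then show ?thesis using ip_self_Re[of d x]
    by (intro exI[of _ "sqrt (Re (ip d x x))"]) simp
qed

text \<open>Nested orthonormal sets stand for nested subspaces, and the difference of two such sets
  for the orthogonal complement of the smaller subspace in the larger. Distinct elements necessarily
  differ below \<open>d\<close>, as their inner product would otherwise be 1.\<close>

definition orthonormal :: "nat \<Rightarrow> (nat \<Rightarrow> complex) set \<Rightarrow> bool" where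
  "orthonormal d F \<longleftrightarrow> finite F \<and> (\<forall>f\<in>F. \<forall>g\<in>F. ip d f g = (if f = g then 1 else 0))"

text \<open>For orthonormal \<open>F\<close>, the Fourier expansion along \<open>F\<close>
  characterizes membership in the linear span.\<close>

definition in_span :: "nat \<Rightarrow> (nat \<Rightarrow> complex) set \<Rightarrow> (nat \<Rightarrow> complex) \<Rightarrow> bool" where
  "in_span d F x \<longleftrightarrow> (\<forall>a<d. x a = (\<Sum>f\<in>F. ip d x f * f a))"

section \<open>Expansion along orthonormal sets and Gram-Schmidt\<close>

lemma orthonormalD: "orthonormal d F \<Longrightarrow> f \<in> F \<Longrightarrow> g \<in> F \<Longrightarrow> ip d f g = (if f = g then 1 else 0)"
  by (simp add: orthonormal_def)

lemma orthonormal_finite: "orthonormal d F \<Longrightarrow> finite F"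
  by (simp add: orthonormal_def)

lemma orthonormal_subset:
  assumes "orthonormal d F" "G \<subseteq> F"
  shows "orthonormal d G"
  unfolding orthonormal_def
proof (intro conjI ballI)
  show "finite G" using assms by (meson finite_subset orthonormal_finite)
  fix f g assume "f \<in> G" "g \<in> G"
  then have "f \<in> F" "g \<in> F" using assms(2) by auto
  then show "ip d f g = (if f = g then 1 else 0)" by (rule orthonormalD[OF assms(1)])
qed

lemma in_span_ip:
  assumes "in_span d F x"
  shows "ip d x v = (\<Sum>f\<in>F. ip d x f * ip d f v)"
proof -
  have "ip d x v = ip d (\<lambda>a. \<Sum>f\<in>F. ip d x f * f a) v"
    using assms by (intro ip_cong) (auto simp: in_span_def)
  also have "\<dots> = (\<Sum>f\<in>F. ip d x f * ip d f v)"
    using ip_sum_left[of d "\<lambda>f. ip d x f" "\<lambda>f. f" F v] by simp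
  finally show ?thesis .
qed

lemma in_span_parseval:
  assumes "in_span d F x"
  shows "(\<Sum>f\<in>F. (cmod (ip d x f))\<^sup>2) = Re (ip d x x)"
  by (subst in_span_ip[OF assms]) (simp add: ip_mult_commute)

text \<open>The vector \<open>x\<close> is a combination of elements of \<open>F\<close>, to which
  the added vectors of \<open>G\<close> are orthogonal; their coefficients vanish.\<close>

lemma in_span_mono:
  assumes x: "in_span d F x" and G: "orthonormal d G" and FG: "F \<subseteq> G"
  shows "in_span d G x"
proof -
  have 0: "ip d x g = 0" if "g \<in> G - F" for g
  proof -
    have "ip d f g = 0" if "f \<in> F" for f
      using orthonormalD[OF G, of f g] FG \<open>g \<in> G - F\<close> that by auto
    then show ?thesis unfolding in_span_ip[OF x, of g] by simp
  qed
  have "(\<Sum>f\<in>G. ip d x f * f a) = (\<Sum>f\<in>F. ip d x f * f a)" for a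
    using orthonormal_finite[OF G] FG by (intro sum.mono_neutral_right) (auto simp: 0)
  then show ?thesis using x by (simp add: in_span_def)
qed

text \<open>Subtracting from \<open>x\<close> its projection onto the span of \<open>F\<close>
  leaves \<open>y\<close> orthogonal to \<open>F\<close>. If \<open>y\<close> vanishes,
  \<open>F\<close> suffices; otherwise the normalized \<open>y\<close> is the only vector
  added.\<close>

lemma gram_schmidt_step:
  assumes F: "orthonormal d F"
  shows "\<exists>G. orthonormal d G \<and> F \<subseteq> G \<and> card G \<le> card F + 1 \<and> in_span d G x"
proof -
  define y where "y = (\<lambda>a. x a - (\<Sum>f\<in>F. ip d x f * f a))"
  have y0: "ip d y g = 0" if "g \<in> F" for g
  proof -
    have "ip d y g = ip d x g - (\<Sum>f\<in>F. ip d x f * ip d f g)"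
      unfolding y_def ip_diff_left
      using ip_sum_left[of d "\<lambda>f. ip d x f" "\<lambda>f. f" F g] by simp
    also have "(\<Sum>f\<in>F. ip d x f * ip d f g) = (\<Sum>f\<in>F. if f = g then ip d x f else 0)"
      using F that by (intro sum.cong) (auto simp: orthonormal_def)
    also have "\<dots> = ip d x g" using F that by (simp add: orthonormal_def)
    finally show ?thesis by simp
  qed
  show ?thesis
  proof (cases "ip d y y = 0")
    case True
    then have "in_span d F x"
      unfolding in_span_def by (auto dest: ip_self_eq_0D simp: y_def)
    then show ?thesis using F by auto
  next
    case False
    then obtain n where n: "n > 0" and nn: "ip d y y = complex_of_real (n\<^sup>2)"
      using ip_self_square by blast
    define g where "g = (\<lambda>a. complex_of_real (1 / n) * y a)"
    have gg: "ip d g g = 1"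
      using n unfolding g_def ip_scale_left ip_scale_right nn
      by (simp add: power2_eq_square)
    have gF: "ip d g f = 0" if "f \<in> F" for f
      using y0[OF that] unfolding g_def ip_scale_left by simp
    have Fg: "ip d f g = 0" if "f \<in> F" for f
      using gF[OF that] by (metis cnj_ip complex_cnj_zero)
    have gnF: "g \<notin> F" using gF gg by force
    have o: "orthonormal d (insert g F)"
      using F gg gF Fg gnF by (auto simp: orthonormal_def)
    have xg: "ip d x g = n"
    proof -
      have "ip d x g = ip d y g + ip d (\<lambda>a. \<Sum>f\<in>F. ip d x f * f a) g"
        unfolding y_def ip_diff_left by simp
      also have "ip d (\<lambda>a. \<Sum>f\<in>F. ip d x f * f a) g = 0"
        using ip_sum_left[of d "\<lambda>f. ip d x f" "\<lambda>f. f" F g] Fg by simp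
      also have "ip d y g = n"
        unfolding g_def ip_scale_right nn using n by (simp add: power2_eq_square)
      finally show ?thesis by simp
    qed
    have "in_span d (insert g F) x"
      unfolding in_span_def
    proof (intro allI impI)
      fix a assume "a < d"
      have "(\<Sum>f\<in>insert g F. ip d x f * f a) = n * g a + (\<Sum>f\<in>F. ip d x f * f a)"
        using F gnF by (simp add: orthonormal_def xg)
      also have "n * g a = y a" using n by (simp add: g_def)
      finally show "x a = (\<Sum>f\<in>insert g F. ip d x f * f a)" by (simp add: y_def)
    qed
    then show ?thesis using o F gnF
      by (intro exI[of _ "insert g F"]) (auto simp: orthonormal_def)
  qed
qed

lemma gram_schmidt_set:
  assumes "finite I" and "orthonormal d F"
  shows "\<exists>G. orthonormal d G \<and> F \<subseteq> G \<and> card G \<le> card F + card I \<and> (\<forall>i\<in>I. in_span d G (x i))"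
  using assms
proof (induction I rule: finite_induct)
  case (insert i I)
  then obtain G where G: "orthonormal d G" "F \<subseteq> G" "card G \<le> card F + card I" "\<forall>i\<in>I. in_span d G (x i)"
    by auto
  obtain H where "orthonormal d H" "G \<subseteq> H" "card H \<le> card G + 1" "in_span d H (x i)"
    using gram_schmidt_step[OF G(1)] by blast
  then show ?case using G insert.hyps
    by (intro exI[of _ H]) (auto intro: in_span_mono)
qed auto

lemma orthonormal_bessel:
  assumes F: "orthonormal d F"
  shows "(\<Sum>f\<in>F. (cmod (ip d v f))\<^sup>2) \<le> Re (ip d v v)"
proof -
  obtain G where G: "orthonormal d G" "F \<subseteq> G" "in_span d G v"
    using gram_schmidt_step[OF F] by blast
  have "(\<Sum>f\<in>F. (cmod (ip d v f))\<^sup>2) \<le> (\<Sum>f\<in>G. (cmod (ip d v f))\<^sup>2)"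
    using G by (intro sum_mono2) (auto simp: orthonormal_def)
  then show ?thesis by (simp add: in_span_parseval[OF G(3)])
qed

text \<open>With \<open>U\<close> the projection onto the span of \<open>F\<close> and \<open>M = \<Sum>i. |y i\<rangle>\<langle>y i|\<close>, so that \<open>U M = M\<close>,
  this is \<open>\<langle>v, (U - M)\<^sup>2 v\<rangle> \<ge> 0\<close>.\<close>

lemma projection_defect_nonneg:
  fixes y :: "'i \<Rightarrow> nat \<Rightarrow> complex"
  assumes F: "orthonormal d F" and Y: "finite Y" "\<And>i. i \<in> Y \<Longrightarrow> in_span d F (y i)"
  shows "0 \<le> (\<Sum>f\<in>F. (cmod (ip d v f))\<^sup>2) - 2 * (\<Sum>i\<in>Y. (cmod (ip d v (y i)))\<^sup>2)
    + Re (\<Sum>i\<in>Y. \<Sum>j\<in>Y. ip d v (y i) * ip d (y i) (y j) * ip d (y j) v)"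
proof -
  define p where "p = (\<lambda>a. \<Sum>f\<in>F. ip d v f * f a)"
  define m where "m = (\<lambda>a. \<Sum>i\<in>Y. ip d v (y i) * y i a)"
  have p: "ip d p z = (\<Sum>f\<in>F. ip d v f * ip d f z)" for z
    unfolding p_def using ip_sum_left[of d "\<lambda>f. ip d v f" "\<lambda>f. f" F] by simp
  have m: "ip d m z = (\<Sum>i\<in>Y. ip d v (y i) * ip d (y i) z)" for z
    unfolding m_def by (rule ip_sum_left)
  have py: "ip d p (y i) = ip d v (y i)" if "i \<in> Y" for i
  proof -
    have "ip d v (y i) = cnj (ip d (y i) v)" by (simp add: cnj_ip)
    also have "\<dots> = (\<Sum>f\<in>F. ip d v f * ip d f (y i))"
      by (subst in_span_ip[OF Y(2)[OF that]]) (simp add: cnj_ip mult.commute)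
    finally show ?thesis by (simp add: p)
  qed
  have mm: "ip d m m = (\<Sum>i\<in>Y. \<Sum>j\<in>Y. ip d v (y i) * ip d (y i) (y j) * ip d (y j) v)"
    unfolding m_def by (rule ip_frame)
  have pm: "ip d p m = complex_of_real (\<Sum>i\<in>Y. (cmod (ip d v (y i)))\<^sup>2)"
  proof -
    have "ip d p m = (\<Sum>i\<in>Y. cnj (ip d v (y i)) * ip d p (y i))"
      unfolding m_def by (rule ip_sum_right)
    also have "\<dots> = (\<Sum>i\<in>Y. complex_of_real ((cmod (ip d v (y i)))\<^sup>2))"
      by (intro sum.cong refl) (simp add: py cnj_ip ip_mult_commute cmod_ip_commute)
    finally show ?thesis by simp
  qed
  then have mp: "ip d m p = complex_of_real (\<Sum>i\<in>Y. (cmod (ip d v (y i)))\<^sup>2)"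
    by (metis cnj_ip complex_cnj_complex_of_real)
  have pf: "ip d p f = ip d v f" if "f \<in> F" for f
  proof -
    have "ip d p f = (\<Sum>g\<in>F. if g = f then ip d v g else 0)"
      unfolding p using F that by (intro sum.cong) (auto simp: orthonormal_def)
    then show ?thesis using F that by (simp add: orthonormal_def)
  qed
  have pp: "ip d p p = complex_of_real (\<Sum>f\<in>F. (cmod (ip d v f))\<^sup>2)"
  proof -
    have "ip d p p = (\<Sum>f\<in>F. cnj (ip d v f) * ip d p f)"
      unfolding p_def using ip_sum_right[of d _ "\<lambda>f. ip d v f" "\<lambda>f. f" F] by simp
    also have "\<dots> = (\<Sum>f\<in>F. complex_of_real ((cmod (ip d v f))\<^sup>2))"
      by (intro sum.cong refl) (simp add: pf cnj_ip ip_mult_commute cmod_ip_commute)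
    finally show ?thesis by simp
  qed
  have "0 \<le> Re (ip d (\<lambda>a. p a - m a) (\<lambda>a. p a - m a))" by (rule ip_self_nonneg)
  also have "ip d (\<lambda>a. p a - m a) (\<lambda>a. p a - m a) = ip d p p - ip d p m - ip d m p + ip d m m"
    by (simp add: ip_diff_left ip_diff_right)
  finally show ?thesis by (simp add: pp pm mp mm)
qed

text \<open>Orthonormality and completeness are both demanded, so that Parseval needs no dimension
  count.\<close>

definition onb :: "nat \<Rightarrow> (nat \<Rightarrow> nat \<Rightarrow> complex) \<Rightarrow> bool" where
  "onb d x \<longleftrightarrow> (\<forall>k<d. \<forall>l<d. ip d (x k) (x l) = (if k = l then 1 else 0)) \<and>
     (\<forall>a<d. \<forall>b<d. (\<Sum>k<d. x k a * cnj (x k b)) = (if a = b then 1 else 0))"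

section \<open>Parseval identities and the overlap with a join of subspaces\<close>

lemma onb_parseval:
  assumes "onb d x"
  shows "(\<Sum>k<d. ip d u (x k) * ip d (x k) v) = ip d u v"
proof -
  have "(\<Sum>k<d. ip d u (x k) * ip d (x k) v)
      = (\<Sum>k<d. \<Sum>a<d. \<Sum>b<d. u b * cnj (v a) * (x k a * cnj (x k b)))"
    unfolding ip_def by (simp add: sum_product algebra_simps) (rule sum.cong[OF refl], rule sum.swap)
  also have "\<dots> = (\<Sum>a<d. \<Sum>b<d. u b * cnj (v a) * (\<Sum>k<d. x k a * cnj (x k b)))"
    by (subst sum.swap, rule sum.cong[OF refl], subst sum.swap) (simp add: sum_distrib_left)
  also have "\<dots> = (\<Sum>a<d. \<Sum>b<d. if a = b then u b * cnj (v a) else 0)"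
    using assms by (intro sum.cong refl) (auto simp: onb_def)
  also have "\<dots> = ip d u v" by (simp add: ip_def)
  finally show ?thesis .
qed

lemma onb_parseval_norm:
  assumes "onb d x"
  shows "(\<Sum>k<d. (cmod (ip d (x k) v))\<^sup>2) = Re (ip d v v)"
proof -
  have "complex_of_real (\<Sum>k<d. (cmod (ip d (x k) v))\<^sup>2) = (\<Sum>k<d. ip d v (x k) * ip d (x k) v)"
    by (simp add: ip_mult_commute cmod_ip_commute)
  also have "\<dots> = ip d v v" by (rule onb_parseval[OF assms])
  finally show ?thesis by (metis Re_complex_of_real)
qed

text \<open>Let \<open>U\<close> be the projection onto the span of \<open>F\<close> and
  \<open>M = \<Sum>i. |y i><y i|\<close>. In the proof, \<open>A k\<close>, \<open>B k\<close> and
  \<open>C k\<close> are the expectations of \<open>U\<close>, \<open>M\<close> and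
  \<open>M^2\<close> at \<open>x k\<close>. By \<open>U = 2 M - M^2 + (U - M)^2\<close>, the sum of
  \<open>A k\<close> over \<open>K\<close> is at most that of \<open>2 * B k\<close> plus the part
  of \<open>(U - M)^2\<close> over \<open>K\<close>. As this square is positive, that part is at
  most its full trace, which is at most \<open>Tr (M^2 - M)\<close> because
  \<open>Tr U \<le> Tr M\<close>. For unit vectors \<open>y i\<close> only the off-diagonal overlaps
  remain there.\<close>

lemma overlap_with_join:
  fixes y :: "'i \<Rightarrow> nat \<Rightarrow> complex"
  assumes x: "onb d x" and K: "K \<subseteq> {..<d}"
    and F: "orthonormal d F" and Y: "finite Y" "\<And>i. i \<in> Y \<Longrightarrow> in_span d F (y i)"
    and y1: "\<And>i. i \<in> Y \<Longrightarrow> ip d (y i) (y i) = 1" and card: "card F \<le> card Y"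
  shows "(\<Sum>k\<in>K. \<Sum>f\<in>F. (cmod (ip d (x k) f))\<^sup>2)
     \<le> 2 * (\<Sum>k\<in>K. \<Sum>i\<in>Y. (cmod (ip d (x k) (y i)))\<^sup>2)
       + (\<Sum>i\<in>Y. \<Sum>j\<in>Y - {i}. (cmod (ip d (y i) (y j)))\<^sup>2)"
proof -
  define A where "A k = (\<Sum>f\<in>F. (cmod (ip d (x k) f))\<^sup>2)" for k
  define B where "B k = (\<Sum>i\<in>Y. (cmod (ip d (x k) (y i)))\<^sup>2)" for k
  define C where "C k = (\<Sum>i\<in>Y. \<Sum>j\<in>Y. ip d (x k) (y i) * ip d (y i) (y j) * ip d (y j) (x k))" for k
  have C: "Re (C k) \<ge> 0" for k
  proof -
    define m where "m = (\<lambda>a. \<Sum>i\<in>Y. ip d (x k) (y i) * y i a)"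
    have "C k = ip d m m"
      unfolding C_def m_def by (rule ip_frame[symmetric])
    then show ?thesis by (simp add: ip_self_nonneg)
  qed
  have pos: "0 \<le> A k - 2 * B k + Re (C k)" for k
    unfolding A_def B_def C_def by (rule projection_defect_nonneg[OF F Y])
  have sA: "(\<Sum>k<d. A k) = card F"
  proof -
    have "(\<Sum>k<d. A k) = (\<Sum>f\<in>F. Re (ip d f f))"
      unfolding A_def by (subst sum.swap) (simp add: onb_parseval_norm[OF x])
    also have "\<dots> = (\<Sum>f\<in>F. 1)" using F by (intro sum.cong) (auto simp: orthonormal_def)
    finally show ?thesis by simp
  qed
  have sB: "(\<Sum>k<d. B k) = card Y"
    unfolding B_def by (subst sum.swap) (simp add: onb_parseval_norm[OF x] y1)
  have sC: "Re (\<Sum>k<d. C k) = (\<Sum>i\<in>Y. \<Sum>j\<in>Y. (cmod (ip d (y i) (y j)))\<^sup>2)"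
  proof -
    have "(\<Sum>k<d. C k) = (\<Sum>i\<in>Y. \<Sum>j\<in>Y. \<Sum>k<d. ip d (x k) (y i) * ip d (y i) (y j) * ip d (y j) (x k))"
      unfolding C_def by (subst sum.swap, rule sum.cong[OF refl], rule sum.swap)
    also have "\<dots> = (\<Sum>i\<in>Y. \<Sum>j\<in>Y. ip d (y i) (y j) * (\<Sum>k<d. ip d (y j) (x k) * ip d (x k) (y i)))"
      by (simp add: sum_distrib_left algebra_simps)
    also have "\<dots> = (\<Sum>i\<in>Y. \<Sum>j\<in>Y. complex_of_real ((cmod (ip d (y i) (y j)))\<^sup>2))"
      by (simp add: onb_parseval[OF x] ip_mult_commute)
    finally show ?thesis by simp
  qed
  have diag: "(\<Sum>i\<in>Y. \<Sum>j\<in>Y. (cmod (ip d (y i) (y j)))\<^sup>2)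
      = card Y + (\<Sum>i\<in>Y. \<Sum>j\<in>Y - {i}. (cmod (ip d (y i) (y j)))\<^sup>2)"
  proof -
    have "(\<Sum>j\<in>Y. (cmod (ip d (y i) (y j)))\<^sup>2) = 1 + (\<Sum>j\<in>Y - {i}. (cmod (ip d (y i) (y j)))\<^sup>2)"
      if "i \<in> Y" for i
      using sum.remove[OF Y(1) that, of "\<lambda>j. (cmod (ip d (y i) (y j)))\<^sup>2"] y1[OF that] by simp
    then show ?thesis by (simp add: sum.distrib)
  qed
  have "(\<Sum>k\<in>K. A k) \<le> (\<Sum>k\<in>K. 2 * B k) + (\<Sum>k\<in>K. A k - 2 * B k + Re (C k))"
    unfolding sum.distrib[symmetric] using C by (intro sum_mono) simp
  also have "(\<Sum>k\<in>K. A k - 2 * B k + Re (C k)) \<le> (\<Sum>k<d. A k - 2 * B k + Re (C k))"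
    using K pos by (intro sum_mono2) auto
  also have "\<dots> = real (card F) - 2 * real (card Y) + Re (\<Sum>k<d. C k)"
    unfolding sum.distrib sum_subtractf sA sum_distrib_left[symmetric] sB by simp
  also have "\<dots> \<le> (\<Sum>i\<in>Y. \<Sum>j\<in>Y - {i}. (cmod (ip d (y i) (y j)))\<^sup>2)"
    using card unfolding sC diag by simp
  finally show ?thesis by (simp add: A_def B_def sum_distrib_left)
qed

section \<open>The flag measurement\<close>

text \<open>Recursion on time: stage \<open>t + 1\<close> adds by Gram-Schmidt the vectors of time
  \<open>t\<close>. Thus \<open>F t\<close> captures those of time strictly before \<open>t\<close>,
  and \<open>F (Suc t) - F t\<close> holds the directions that are new at \<open>t\<close>. The
  cardinality bound supplies \<open>Tr U \<le> Tr M\<close> in the overlap estimate.\<close>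

lemma flag_exists:
  fixes x :: "'i \<Rightarrow> nat \<Rightarrow> complex" and \<tau> :: "'i \<Rightarrow> nat"
  assumes I: "finite I"
  shows "\<exists>F. \<forall>t. (orthonormal d (F t) \<and> card (F t) \<le> card {i\<in>I. \<tau> i < t} \<and>
     (\<forall>i\<in>I. \<tau> i < t \<longrightarrow> in_span d (F t) (x i))) \<and> F t \<subseteq> F (Suc t)"
proof (rule dependent_nat_choice, goal_cases)
  case 1
  show ?case by (rule exI[of _ "{}"]) (auto simp: orthonormal_def)
next
  case (2 F t)
  have fin: "finite {i\<in>I. \<tau> i = t}" "finite {i\<in>I. \<tau> i < t}" using I by auto
  obtain G where G: "orthonormal d G" "F \<subseteq> G" "card G \<le> card F + card {i\<in>I. \<tau> i = t}"
      "\<forall>i\<in>{i\<in>I. \<tau> i = t}. in_span d G (x i)"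
    using gram_schmidt_set[OF fin(1), of d F x] 2 by auto
  have "{i\<in>I. \<tau> i < Suc t} = {i\<in>I. \<tau> i < t} \<union> {i\<in>I. \<tau> i = t}" by auto
  then have "card {i\<in>I. \<tau> i < Suc t} = card {i\<in>I. \<tau> i < t} + card {i\<in>I. \<tau> i = t}"
    using fin by (simp add: card_Un_disjoint disjoint_iff)
  then show ?case using 2 G
    by (intro exI[of _ G]) (auto simp: less_Suc_eq intro: in_span_mono)
qed

text \<open>The first \<open>r\<close> terms are at most \<open>1 / 2 ^ (s div r)\<close> each, and
  the rest is the same kind of sum started at \<open>s + r\<close>, where the weight has halved:
  \<open>r + 2 r / 2 = 2 r\<close>.\<close>

lemma sum_geometric_div:
  fixes r s n :: nat
  assumes r: "0 < r"
  shows "(\<Sum>t = s..<s + n. 1 / 2 ^ (t div r)) \<le> 2 * real r / 2 ^ (s div r)"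
proof (induction n arbitrary: s rule: less_induct)
  case (less n)
  have head: "(\<Sum>t = s..<s + m. 1 / 2 ^ (t div r)) \<le> real r / 2 ^ (s div r)" if "m \<le> r" for m
  proof -
    have "(\<Sum>t = s..<s + m. 1 / 2 ^ (t div r)) \<le> (\<Sum>t = s..<s + m. 1 / 2 ^ (s div r) :: real)"
      by (intro sum_mono divide_left_mono power_increasing div_le_mono) auto
    also have "\<dots> = real m / 2 ^ (s div r)" by simp
    also have "\<dots> \<le> real r / 2 ^ (s div r)" using that by (intro divide_right_mono) auto
    finally show ?thesis .
  qed
  show ?case
  proof (cases "n \<le> r")
    case True
    have "(\<Sum>t = s..<s + n. 1 / 2 ^ (t div r)) \<le> real r / 2 ^ (s div r)" by (rule head[OF True])
    also have "\<dots> \<le> 2 * real r / 2 ^ (s div r)" by (intro divide_right_mono) auto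
    finally show ?thesis .
  next
    case False
    have "(\<Sum>t = s..<s + n. 1 / 2 ^ (t div r))
        = (\<Sum>t = s..<s + r. 1 / 2 ^ (t div r)) + (\<Sum>t = s + r..<(s + r) + (n - r). 1 / 2 ^ (t div r) :: real)"
      using False by (subst sum.atLeastLessThan_concat) auto
    also have "\<dots> \<le> real r / 2 ^ (s div r) + 2 * real r / 2 ^ ((s + r) div r)"
      using False r by (intro add_mono head less.IH) auto
    also have "\<dots> = 2 * real r / 2 ^ (s div r)" using r by simp
    finally show ?thesis .
  qed
qed

text \<open>Rounding up to \<open>W\<close> times a power of one half, within a factor two:
  \<open>j\<close> is the least index with \<open>W / 2 ^ j < 2 * v\<close>, and minimality gives
  the other bound; for \<open>j = 0\<close> it is \<open>v \<le> W\<close>.\<close>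

lemma dyadic_level:
  fixes W v :: real
  assumes "0 < v" "v \<le> W"
  shows "\<exists>j::nat. v \<le> W / 2 ^ j \<and> W / 2 ^ j < 2 * v"
proof -
  obtain n :: nat where "(1 / 2) ^ n < v / W"
    using real_arch_pow_inv[of "v / W" "1/2"] assms by auto
  then have "W / 2 ^ n < v" using assms by (simp add: power_divide field_simps)
  then have ex: "\<exists>j::nat. W / 2 ^ j < 2 * v" using assms by (intro exI[of _ n]) linarith
  define j where "j = (LEAST j::nat. W / 2 ^ j < 2 * v)"
  have j: "W / 2 ^ j < 2 * v" unfolding j_def using ex by (rule LeastI_ex)
  have "v \<le> W / 2 ^ j"
  proof (cases j)
    case (Suc i)
    then have "\<not> W / 2 ^ i < 2 * v" using not_less_Least[of i "\<lambda>j. W / 2 ^ j < 2 * v"] j_def by auto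
    then show ?thesis using Suc by simp
  qed (use assms in simp)
  with j show ?thesis by blast
qed

text \<open>The classical optimal error of discriminating the two Nussbaum-Szkola distributions,
  whose weights at \<open>(k, l)\<close> are \<open>e k\<close> and \<open>f l\<close> times the
  squared inner product.\<close>

definition overlap :: "nat \<Rightarrow> (nat \<Rightarrow> real) \<Rightarrow> (nat \<Rightarrow> nat \<Rightarrow> complex) \<Rightarrow> (nat \<Rightarrow> real) \<Rightarrow> (nat \<Rightarrow> nat \<Rightarrow> complex) \<Rightarrow> real" where
  "overlap d e x f y = (\<Sum>k<d. \<Sum>l<d. min (e k) (f l) * (cmod (ip d (x k) (y l)))\<^sup>2)"

text \<open>The span of \<open>G i\<close> is the subspace on which hypothesis \<open>i\<close> is
  chosen. With \<open>M\<close> the double sum of overlaps, the constant is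
  \<open>2 * 2 + 4 * r\<close>: the overlaps of each eigenspace with the earlier vectors count twice
  and amount to at most \<open>2 * M\<close>, and the mutual overlaps of the earlier vectors sum
  geometrically to at most \<open>4 * r * M\<close>.\<close>

theorem flag_measurement:
  fixes x :: "nat \<Rightarrow> nat \<Rightarrow> nat \<Rightarrow> complex" and e :: "nat \<Rightarrow> nat \<Rightarrow> real"
  assumes r: "0 < r" and x: "\<And>i. i < r \<Longrightarrow> onb d (x i)" and e: "\<And>i k. i < r \<Longrightarrow> k < d \<Longrightarrow> 0 \<le> e i k"
  shows "\<exists>G. orthonormal d (\<Union>i<r. G i) \<and> (\<forall>i<r. \<forall>j<r. i \<noteq> j \<longrightarrow> G i \<inter> G j = {}) \<and>
    (\<Sum>i<r. \<Sum>k<d. e i k * (1 - (\<Sum>f\<in>G i. (cmod (ip d (x i k) f))\<^sup>2)))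
      \<le> 4 * (real r + 1) * (\<Sum>i<r. \<Sum>j\<in>{..<r} - {i}. overlap d (e i) (x i) (e j) (x j))"
proof -
  \<comment> \<open>A common bound of all eigenvalues; the summand 1 keeps it positive even if all
    of them vanish.\<close>
  define W where "W = 1 + (\<Sum>i<r. \<Sum>k<d. e i k)"
  define I where "I = {p \<in> {..<r} \<times> {..<d}. 0 < e (fst p) (snd p)}"
  define X where "X p = x (fst p) (snd p)" for p
  define L where "L p = e (fst p) (snd p)" for p
  define c where "c p q = (cmod (ip d (X p) (X q)))\<^sup>2" for p q
  have finI: "finite I" by (simp add: I_def)
  have LW: "L p \<le> W" if "p \<in> I" for p
  proof -
    have p: "fst p < r" "snd p < d" using that by (auto simp: I_def)
    have "L p \<le> (\<Sum>k<d. e (fst p) k)"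
      unfolding L_def using p e by (intro member_le_sum) auto
    also have "\<dots> \<le> (\<Sum>i<r. \<Sum>k<d. e i k)"
      using p e by (intro member_le_sum[of "fst p" _ "\<lambda>i. \<Sum>k<d. e i k"]) (auto intro: sum_nonneg)
    finally show ?thesis by (simp add: W_def)
  qed
  have Lpos: "0 < L p" if "p \<in> I" for p using that by (simp add: I_def L_def)
  have "\<forall>p\<in>I. \<exists>j::nat. L p \<le> W / 2 ^ j \<and> W / 2 ^ j < 2 * L p"
    using dyadic_level Lpos LW by blast
  then obtain lev where lev: "\<And>p. p \<in> I \<Longrightarrow> L p \<le> W / 2 ^ lev p \<and> W / 2 ^ lev p < 2 * L p"
    by metis
  \<comment> \<open>the time at which an eigenvector enters the flag, ordered first by level and then by hypothesis\<close>
  define \<tau> where "\<tau> p = lev p * r + fst p" for p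
  \<comment> \<open>Since \<open>fst p < r\<close>, dividing a time by \<open>r\<close> returns the
    level, with the hypothesis as remainder. So \<open>w (\<tau> p)\<close> is the eigenvalue
    \<open>L p\<close> rounded up, at most \<open>2 * L p\<close>, and \<open>w\<close> does not
    increase in time.\<close>
  define w where "w t = W / 2 ^ (t div r)" for t
  have Wpos: "0 < W" using e unfolding W_def by (intro add_pos_nonneg sum_nonneg) auto
  have \<tau>div: "\<tau> p div r = lev p" and \<tau>mod: "\<tau> p mod r = fst p" if "p \<in> I" for p
    using that r by (auto simp: \<tau>_def I_def)
  have w1: "L p \<le> w (\<tau> p)" and w2: "w (\<tau> p) \<le> 2 * L p" if "p \<in> I" for p
    using lev[OF that] by (auto simp: w_def \<tau>div[OF that])
  have wmono: "w t \<le> w s" if "s \<le> t" for s t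
    using that Wpos unfolding w_def by (intro divide_left_mono power_increasing div_le_mono) auto
  have wpos: "0 < w t" for t using Wpos by (simp add: w_def)
  have XX: "ip d (X p) (X p) = 1" if "p \<in> I" for p
    using x that unfolding X_def I_def onb_def by auto
  have c0: "c p q = 0" if "p \<in> I" "q \<in> I" "p \<noteq> q" "fst p = fst q" for p q
    using x that unfolding c_def X_def I_def onb_def by (auto simp: prod_eq_iff)
  have cpos: "0 \<le> c p q" for p q by (simp add: c_def)
  obtain F where F: "\<And>t. orthonormal d (F t)" "\<And>t. card (F t) \<le> card {p\<in>I. \<tau> p < t}"
      "\<And>t p. p \<in> I \<Longrightarrow> \<tau> p < t \<Longrightarrow> in_span d (F t) (X p)" "\<And>t. F t \<subseteq> F (Suc t)"
    using flag_exists[OF finI, of d \<tau> X] by metis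
  have Fmono: "F s \<subseteq> F t" if "s \<le> t" for s t
    using F(4) that by (rule lift_Suc_mono_le)
  obtain T where T: "\<And>p. p \<in> I \<Longrightarrow> \<tau> p < T"
    using finite_nat_set_iff_bounded[of "\<tau> ` I"] finI by auto
  \<comment> \<open>The vectors of time \<open>t\<close> are captured at stage \<open>Suc t\<close>;
    the directions new at that stage go to hypothesis \<open>t mod r\<close>.\<close>
  define G where "G i = (\<Union>t\<in>{t. t < T \<and> t mod r = i}. F (Suc t) - F t)" for i
  have GF: "G i \<subseteq> F T" for i
  proof
    fix f assume "f \<in> G i"
    then obtain t where "t < T" "f \<in> F (Suc t)" by (auto simp: G_def)
    then show "f \<in> F T" using Fmono[of "Suc t" T] by auto
  qed
  have "orthonormal d (\<Union>i<r. G i)"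
    using GF by (intro orthonormal_subset[OF F(1)[of T]]) auto
  moreover have "G i \<inter> G j = {}" if "i \<noteq> j" for i j
  proof -
    \<comment> \<open>By monotonicity a vector enters the flag at only one time, and this time
      determines the hypothesis.\<close>
    have "s = t" if "f \<in> F (Suc s) - F s" "f \<in> F (Suc t) - F t" for f s t
    proof (rule ccontr)
      assume "s \<noteq> t"
      then consider "Suc s \<le> t" | "Suc t \<le> s" by linarith
      then show False using that Fmono[of "Suc s" t] Fmono[of "Suc t" s] by cases auto
    qed
    note eq = this
    show ?thesis
    proof (rule equals0I)
      fix f assume "f \<in> G i \<inter> G j"
      then obtain s t where "s mod r = i" "f \<in> F (Suc s) - F s" "t mod r = j" "f \<in> F (Suc t) - F t"
        by (auto simp: G_def)
      then show False using eq[of f s t] \<open>i \<noteq> j\<close> by simp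
    qed
  qed
  moreover have "(\<Sum>i<r. \<Sum>k<d. e i k * (1 - (\<Sum>f\<in>G i. (cmod (ip d (x i k) f))\<^sup>2)))
      \<le> 4 * (real r + 1) * (\<Sum>i<r. \<Sum>j\<in>{..<r} - {i}. overlap d (e i) (x i) (e j) (x j))"
  proof -
    define err where "err p = 1 - (\<Sum>f\<in>G (fst p). (cmod (ip d (X p) f))\<^sup>2)" for p
    define q where "q p = (\<Sum>f\<in>F (\<tau> p). (cmod (ip d (X p) f))\<^sup>2)" for p
    define Y where "Y t = {p\<in>I. \<tau> p < t}" for t
    define M where "M = (\<Sum>p\<in>I. \<Sum>p'\<in>I. if fst p = fst p' then 0 else min (L p) (L p') * c p p')"
    \<comment> \<open>Parseval splits the unit norm of \<open>X p\<close> over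
      \<open>F (Suc ?t)\<close> into the old part \<open>q p\<close> and the new directions, which
      \<open>G (fst p)\<close> contains.\<close>
    have err_le: "err p \<le> q p" if p: "p \<in> I" for p
    proof -
      let ?t = "\<tau> p"
      have "in_span d (F (Suc ?t)) (X p)" using F(3)[OF p] by simp
      then have "(\<Sum>f\<in>F (Suc ?t). (cmod (ip d (X p) f))\<^sup>2) = 1"
        by (simp add: in_span_parseval XX[OF p])
      moreover have "(\<Sum>f\<in>F (Suc ?t). (cmod (ip d (X p) f))\<^sup>2) =
          (\<Sum>f\<in>F (Suc ?t) - F ?t. (cmod (ip d (X p) f))\<^sup>2) + q p"
        unfolding q_def using F(4) orthonormal_finite[OF F(1)] by (intro sum.subset_diff) auto
      moreover have "(\<Sum>f\<in>F (Suc ?t) - F ?t. (cmod (ip d (X p) f))\<^sup>2) \<le> (\<Sum>f\<in>G (fst p). (cmod (ip d (X p) f))\<^sup>2)"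
        using T[OF p] \<tau>mod[OF p] GF orthonormal_finite[OF F(1)[of T]]
        by (intro sum_mono2) (auto simp: G_def intro: finite_subset)
      ultimately show ?thesis by (simp add: err_def)
    qed
    have qpos: "0 \<le> q p" for p by (simp add: q_def sum_nonneg)
    have "(\<Sum>i<r. \<Sum>k<d. e i k * (1 - (\<Sum>f\<in>G i. (cmod (ip d (x i k) f))\<^sup>2)))
        = (\<Sum>p\<in>{..<r} \<times> {..<d}. L p * err p)"
      unfolding sum.cartesian_product by (intro sum.cong) (auto simp: L_def err_def X_def)
    also have "\<dots> = (\<Sum>p\<in>I. L p * err p)"
      using e by (intro sum.mono_neutral_right) (auto simp: I_def L_def not_less intro: antisym)
    also have "\<dots> \<le> (\<Sum>p\<in>I. w (\<tau> p) * q p)"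
    proof (rule sum_mono)
      fix p assume p: "p \<in> I"
      have "L p * err p \<le> L p * q p" using err_le[OF p] Lpos[OF p] by simp
      also have "\<dots> \<le> w (\<tau> p) * q p" using w1[OF p] qpos by (intro mult_right_mono) auto
      finally show "L p * err p \<le> w (\<tau> p) * q p" .
    qed
    also have "\<dots> = (\<Sum>t<T. \<Sum>p\<in>{p\<in>I. \<tau> p = t}. w (\<tau> p) * q p)"
      using T finI by (intro sum.group[symmetric]) auto
    also have "\<dots> \<le> (\<Sum>t<T. w t * (2 * (\<Sum>p\<in>{p\<in>I. \<tau> p = t}. \<Sum>p'\<in>Y t. c p p')
        + (\<Sum>p\<in>Y t. \<Sum>p'\<in>Y t - {p}. c p p')))"
    proof (rule sum_mono)
      fix t assume "t \<in> {..<T}"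
      \<comment> \<open>All vectors of time \<open>t\<close> come from the single basis
        \<open>x i\<close>, as the overlap estimate requires; \<open>K\<close> lists their
        indices.\<close>
      define i where "i = t mod r"
      have i: "i < r" using r by (simp add: i_def)
      define K where "K = {k. k < d \<and> (i, k) \<in> I \<and> \<tau> (i, k) = t}"
      have img: "{p\<in>I. \<tau> p = t} = (\<lambda>k. (i, k)) ` K"
        using \<tau>mod by (force simp: K_def i_def I_def)
      have inj: "inj_on (\<lambda>k. (i, k)) K" by (auto simp: inj_on_def)
      have "(\<Sum>k\<in>K. \<Sum>f\<in>F t. (cmod (ip d (x i k) f))\<^sup>2)
          \<le> 2 * (\<Sum>k\<in>K. \<Sum>p'\<in>Y t. (cmod (ip d (x i k) (X p')))\<^sup>2)
            + (\<Sum>p\<in>Y t. \<Sum>p'\<in>Y t - {p}. (cmod (ip d (X p) (X p')))\<^sup>2)"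
        using F XX finI by (intro overlap_with_join[OF x[OF i]]) (auto simp: K_def Y_def)
      then have *: "(\<Sum>p\<in>{p\<in>I. \<tau> p = t}. q p) \<le> 2 * (\<Sum>p\<in>{p\<in>I. \<tau> p = t}. \<Sum>p'\<in>Y t. c p p')
        + (\<Sum>p\<in>Y t. \<Sum>p'\<in>Y t - {p}. c p p')"
        unfolding img sum.reindex[OF inj] by (simp add: q_def c_def X_def K_def)
      have "(\<Sum>p\<in>{p\<in>I. \<tau> p = t}. w (\<tau> p) * q p) = w t * (\<Sum>p\<in>{p\<in>I. \<tau> p = t}. q p)"
        by (simp add: sum_distrib_left)
      also have "\<dots> \<le> w t * (2 * (\<Sum>p\<in>{p\<in>I. \<tau> p = t}. \<Sum>p'\<in>Y t. c p p')
        + (\<Sum>p\<in>Y t. \<Sum>p'\<in>Y t - {p}. c p p'))"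
        using * wpos[of t] by (intro mult_left_mono) auto
      finally show "(\<Sum>p\<in>{p\<in>I. \<tau> p = t}. w (\<tau> p) * q p) \<le> \<dots>" .
    qed
    also have "\<dots> = 2 * (\<Sum>t<T. \<Sum>p\<in>{p\<in>I. \<tau> p = t}. w (\<tau> p) * (\<Sum>p'\<in>Y (\<tau> p). c p p'))
        + (\<Sum>t<T. w t * (\<Sum>p\<in>Y t. \<Sum>p'\<in>Y t - {p}. c p p'))"
      by (simp add: sum_distrib_left sum.distrib distrib_left mult.left_commute)
    also have "(\<Sum>t<T. \<Sum>p\<in>{p\<in>I. \<tau> p = t}. w (\<tau> p) * (\<Sum>p'\<in>Y (\<tau> p). c p p'))
        = (\<Sum>p\<in>I. w (\<tau> p) * (\<Sum>p'\<in>Y (\<tau> p). c p p'))"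
      using T finI by (intro sum.group) auto
    \<comment> \<open>An earlier vector has at least the weight of a later one, so
      \<open>w (\<tau> p)\<close> is at most twice the smaller of the two eigenvalues. Pairs from
      one hypothesis are orthogonal and drop out.\<close>
    also have "\<dots> \<le> 2 * M"
    proof -
      have "w (\<tau> p) * (\<Sum>p'\<in>Y (\<tau> p). c p p')
          \<le> (\<Sum>p'\<in>I. 2 * (if fst p = fst p' then 0 else min (L p) (L p') * c p p'))"
        if p: "p \<in> I" for p
      proof -
        have "w (\<tau> p) * (\<Sum>p'\<in>Y (\<tau> p). c p p') = (\<Sum>p'\<in>Y (\<tau> p). w (\<tau> p) * c p p')"
          by (simp add: sum_distrib_left)
        also have "\<dots> \<le> (\<Sum>p'\<in>Y (\<tau> p). 2 * (if fst p = fst p' then 0 else min (L p) (L p') * c p p'))"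
        proof (rule sum_mono)
          fix p' assume "p' \<in> Y (\<tau> p)"
          then have p': "p' \<in> I" "\<tau> p' < \<tau> p" by (auto simp: Y_def)
          show "w (\<tau> p) * c p p' \<le> 2 * (if fst p = fst p' then 0 else min (L p) (L p') * c p p')"
          proof (cases "fst p = fst p'")
            case True
            moreover have "p \<noteq> p'" using p'(2) by auto
            ultimately show ?thesis using c0[OF p p'(1)] by simp
          next
            case False
            have "w (\<tau> p) \<le> 2 * min (L p) (L p')"
              using w2[OF p] w2[OF p'(1)] wmono[of "\<tau> p'" "\<tau> p"] p'(2) by auto
            then show ?thesis using False cpos[of p p'] by (simp add: mult_right_mono mult.assoc[symmetric])
          qed
        qed
        also have "\<dots> \<le> (\<Sum>p'\<in>I. 2 * (if fst p = fst p' then 0 else min (L p) (L p') * c p p'))"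
          using finI cpos Lpos p by (intro sum_mono2) (auto simp: Y_def less_imp_le)
        finally show ?thesis .
      qed
      then show ?thesis unfolding M_def by (simp add: sum_distrib_left sum_mono)
    qed
    \<comment> \<open>A pair recurs at every time after both of its members. Summing over these
      times first gives a geometric series dominated by its start \<open>s\<close>: the weights add
      up to at most \<open>2 * r * w s\<close>, hence to at most \<open>4 * r\<close> times the
      smaller eigenvalue.\<close>
    also have "(\<Sum>t<T. w t * (\<Sum>p\<in>Y t. \<Sum>p'\<in>Y t - {p}. c p p')) \<le> 4 * real r * M"
    proof -
      have "(\<Sum>t<T. w t * (\<Sum>p\<in>Y t. \<Sum>p'\<in>Y t - {p}. c p p'))
          = (\<Sum>t<T. \<Sum>p\<in>I. \<Sum>p'\<in>I. if \<tau> p < t \<and> \<tau> p' < t \<and> p \<noteq> p' then w t * c p p' else 0)"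
      proof (rule sum.cong[OF refl])
        fix t
        have "(\<Sum>p\<in>Y t. \<Sum>p'\<in>Y t - {p}. w t * c p p')
           = (\<Sum>p\<in>I. if \<tau> p < t then (\<Sum>p'\<in>I. if \<tau> p' < t \<and> p \<noteq> p' then w t * c p p' else 0) else 0)"
          unfolding Y_def sum.inter_filter[OF finI, symmetric]
          by (intro sum.cong refl) auto
        also have "\<dots> = (\<Sum>p\<in>I. \<Sum>p'\<in>I. if \<tau> p < t \<and> \<tau> p' < t \<and> p \<noteq> p' then w t * c p p' else 0)"
          by (intro sum.cong refl) auto
        finally show "w t * (\<Sum>p\<in>Y t. \<Sum>p'\<in>Y t - {p}. c p p') = \<dots>"
          by (simp add: sum_distrib_left)
      qed
      also have "\<dots> = (\<Sum>p\<in>I. \<Sum>p'\<in>I. \<Sum>t<T. if \<tau> p < t \<and> \<tau> p' < t \<and> p \<noteq> p' then w t * c p p' else 0)"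
        by (subst sum.swap, rule sum.cong[OF refl], rule sum.swap)
      also have "\<dots> \<le> (\<Sum>p\<in>I. \<Sum>p'\<in>I. 4 * real r * (if fst p = fst p' then 0 else min (L p) (L p') * c p p'))"
      proof (intro sum_mono)
        fix p p' assume p: "p \<in> I" and p': "p' \<in> I"
        show "(\<Sum>t<T. if \<tau> p < t \<and> \<tau> p' < t \<and> p \<noteq> p' then w t * c p p' else 0)
            \<le> 4 * real r * (if fst p = fst p' then 0 else min (L p) (L p') * c p p')"
        proof (cases "fst p = fst p'")
          case True
          then show ?thesis using c0[OF p p'] by (auto intro!: sum_nonpos)
        next
          case False
          define s where "s = max (\<tau> p) (\<tau> p')"
          have sT: "s < T" using T[OF p] T[OF p'] by (simp add: s_def)
          have ws: "w s \<le> 2 * min (L p) (L p')"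
            using w2[OF p] w2[OF p'] wmono[of "\<tau> p" s] wmono[of "\<tau> p'" s] by (auto simp: s_def)
          have "(\<Sum>t<T. if \<tau> p < t \<and> \<tau> p' < t \<and> p \<noteq> p' then w t * c p p' else 0)
              \<le> (\<Sum>t = s..<s + (T - s). w t * c p p')"
          proof -
            have "(\<Sum>t<T. if \<tau> p < t \<and> \<tau> p' < t \<and> p \<noteq> p' then w t * c p p' else 0)
              = (\<Sum>t\<in>{t\<in>{..<T}. \<tau> p < t \<and> \<tau> p' < t \<and> p \<noteq> p'}. w t * c p p')"
              by (rule sum.inter_filter[symmetric]) simp
            also have "\<dots> \<le> (\<Sum>t = s..<s + (T - s). w t * c p p')"
              using sT cpos wpos by (intro sum_mono2) (auto simp: s_def less_imp_le)
            finally show ?thesis .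
          qed
          also have "\<dots> = (\<Sum>t = s..<s + (T - s). 1 / 2 ^ (t div r)) * (W * c p p')"
            by (simp add: w_def sum_distrib_right)
          also have "\<dots> \<le> 2 * real r / 2 ^ (s div r) * (W * c p p')"
            using Wpos cpos by (intro mult_right_mono sum_geometric_div r) auto
          also have "\<dots> = 2 * real r * c p p' * w s" by (simp add: w_def)
          also have "\<dots> \<le> 2 * real r * c p p' * (2 * min (L p) (L p'))"
            using ws cpos by (intro mult_left_mono) auto
          finally show ?thesis using False by (simp add: mult_ac)
        qed
      qed
      also have "\<dots> = 4 * real r * M" by (simp add: M_def sum_distrib_left)
      finally show ?thesis .
    qed
    finally have bound: "(\<Sum>i<r. \<Sum>k<d. e i k * (1 - (\<Sum>f\<in>G i. (cmod (ip d (x i k) f))\<^sup>2)))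
        \<le> 4 * (real r + 1) * M"
      by (simp add: algebra_simps)
    \<comment> \<open>Pairs with a zero eigenvalue contribute nothing, so the index set can be
      enlarged to all pairs.\<close>
    have "M = (\<Sum>p\<in>{..<r} \<times> {..<d}. \<Sum>p'\<in>{..<r} \<times> {..<d}.
        if fst p = fst p' then 0 else min (L p) (L p') * c p p')"
    proof -
      have L0: "L p = 0" if "p \<in> {..<r} \<times> {..<d} - I" for p
        using that e by (force simp: I_def L_def not_less intro: antisym)
      have Lnn: "0 \<le> L p" if "p \<in> {..<r} \<times> {..<d}" for p using that e by (auto simp: L_def)
      have sub: "I \<subseteq> {..<r} \<times> {..<d}" by (auto simp: I_def)
      have "M = (\<Sum>p\<in>I. \<Sum>p'\<in>{..<r} \<times> {..<d}. if fst p = fst p' then 0 else min (L p) (L p') * c p p')"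
        unfolding M_def
      proof (intro sum.cong[OF refl] sum.mono_neutral_left sub ballI)
        fix p p' assume "p \<in> I" "p' \<in> {..<r} \<times> {..<d} - I"
        then show "(if fst p = fst p' then 0 else min (L p) (L p') * c p p') = 0"
          using Lpos[of p] L0[of p'] by simp
      qed simp
      also have "\<dots> = (\<Sum>p\<in>{..<r} \<times> {..<d}. \<Sum>p'\<in>{..<r} \<times> {..<d}.
          if fst p = fst p' then 0 else min (L p) (L p') * c p p')"
      proof (intro sum.mono_neutral_left sub ballI sum.neutral)
        fix p p' assume "p \<in> {..<r} \<times> {..<d} - I" "p' \<in> {..<r} \<times> {..<d}"
        then show "(if fst p = fst p' then 0 else min (L p) (L p') * c p p') = 0"
          using L0[of p] Lnn[of p'] by simp
      qed simp
      finally show ?thesis .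
    qed
    also have "\<dots> = (\<Sum>i<r. \<Sum>k<d. \<Sum>j<r. \<Sum>l<d.
        if i = j then 0 else min (e i k) (e j l) * (cmod (ip d (x i k) (x j l)))\<^sup>2)"
    proof -
      have "sum h ({..<r} \<times> {..<d}) = (\<Sum>i<r. \<Sum>k<d. h (i, k))" for h :: "nat \<times> nat \<Rightarrow> real"
        by (simp add: sum.cartesian_product)
      then show ?thesis by (simp only: L_def c_def X_def fst_conv snd_conv)
    qed
    also have "\<dots> = (\<Sum>i<r. \<Sum>j<r. \<Sum>k<d. \<Sum>l<d.
        if i = j then 0 else min (e i k) (e j l) * (cmod (ip d (x i k) (x j l)))\<^sup>2)"
      by (rule sum.cong[OF refl], rule sum.swap)
    also have "\<dots> = (\<Sum>i<r. \<Sum>j<r. if j \<noteq> i then overlap d (e i) (x i) (e j) (x j) else 0)"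
      unfolding overlap_def by (intro sum.cong refl) auto
    also have "\<dots> = (\<Sum>i<r. \<Sum>j\<in>{..<r} - {i}. overlap d (e i) (x i) (e j) (x j))"
    proof (rule sum.cong[OF refl])
      fix i
      have "{..<r} - {i} = {j\<in>{..<r}. j \<noteq> i}" by auto
      then show "(\<Sum>j<r. if j \<noteq> i then overlap d (e i) (x i) (e j) (x j) else 0)
        = (\<Sum>j\<in>{..<r} - {i}. overlap d (e i) (x i) (e j) (x j))"
        by (simp only: sum.inter_filter finite_lessThan)
    qed
    finally show ?thesis using bound by simp
  qed
  ultimately show ?thesis by blast
qed

section \<open>Spectral decomposition\<close>

text \<open>Gram-Schmidt on the standard basis vectors \<open>s b\<close> lets each of them expand
  along \<open>G\<close>, which is the resolution of the identity and makes every vector expand. Its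
  trace, computed in two ways, gives \<open>card G = d\<close>.\<close>

lemma orthonormal_extend:
  assumes F: "orthonormal d F"
  shows "\<exists>G. orthonormal d G \<and> F \<subseteq> G \<and> card G = d \<and> (\<forall>v. in_span d G v) \<and>
    (\<forall>a<d. \<forall>b<d. (\<Sum>f\<in>G. f a * cnj (f b)) = (if a = b then 1 else 0))"
proof -
  define s where "s b = (\<lambda>a. if a = b then 1 else (0::complex))" for b :: nat
  obtain G where G: "orthonormal d G" "F \<subseteq> G" "\<forall>b\<in>{..<d}. in_span d G (s b)"
    using gram_schmidt_set[OF _ F, of "{..<d}" s] by auto
  have sf: "ip d (s b) f = cnj (f b)" if "b < d" for b f
    using that by (simp add: ip_def s_def if_distrib[of "\<lambda>z. z * _"] cong: if_cong)
  have res: "(\<Sum>f\<in>G. f a * cnj (f b)) = (if a = b then 1 else 0)" if "a < d" "b < d" for a b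
  proof -
    have "s b a = (\<Sum>f\<in>G. ip d (s b) f * f a)" using G(3) that by (auto simp: in_span_def)
    then have "s b a = (\<Sum>f\<in>G. f a * cnj (f b))" by (simp only: sf[OF that(2)] mult.commute)
    then show ?thesis by (simp add: s_def)
  qed
  have "in_span d G v" for v
    unfolding in_span_def
  proof (intro allI impI)
    fix a assume a: "a < d"
    have "(\<Sum>f\<in>G. ip d v f * f a) = (\<Sum>b<d. v b * (\<Sum>f\<in>G. f a * cnj (f b)))"
      unfolding ip_def sum_distrib_right sum_distrib_left by (subst sum.swap) (simp add: mult_ac)
    also have "\<dots> = (\<Sum>b<d. if a = b then v b else 0)" using a by (intro sum.cong) (auto simp: res)
    also have "\<dots> = v a" using a by simp
    finally show "v a = (\<Sum>f\<in>G. ip d v f * f a)" by simp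
  qed
  moreover have "complex_of_nat (card G) = complex_of_nat d"
  proof -
    have "complex_of_nat (card G) = (\<Sum>f\<in>G. ip d f f)"
      using orthonormalD[OF G(1)] by simp
    also have "\<dots> = (\<Sum>a<d. \<Sum>f\<in>G. f a * cnj (f a))" unfolding ip_def by (rule sum.swap)
    also have "\<dots> = complex_of_nat d" by (simp add: res)
    finally show ?thesis .
  qed
  ultimately show ?thesis using G res by (intro exI[of _ G]) simp
qed

section \<open>Quadratic forms and the spectral theorem\<close>

definition qform :: "nat \<Rightarrow> complex mat \<Rightarrow> (nat \<Rightarrow> complex) \<Rightarrow> complex" where
  "qform d A v = (\<Sum>a<d. \<Sum>b<d. A $$ (a, b) * v b * cnj (v a))"

lemma psd_iff_qform: "psd d A \<longleftrightarrow> A \<in> carrier_mat d d \<and> (\<forall>v. 0 \<le> qform d A v)"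
proof -
  have eq: "(A *\<^sub>v v) \<bullet>c v = qform d A (\<lambda>a. v $ a)" if "A \<in> carrier_mat d d" "v \<in> carrier_vec d" for v
    using that by (simp add: qform_def scalar_prod_def sum_distrib_right lessThan_atLeast0)
  have vec: "qform d A v = (A *\<^sub>v vec d v) \<bullet>c vec d v" if "A \<in> carrier_mat d d" for v
    unfolding eq[OF that vec_carrier] by (simp add: qform_def)
  show ?thesis
    unfolding psd_def
  proof (intro conj_cong refl iffI ballI allI)
    fix v assume "A \<in> carrier_mat d d" "\<forall>v\<in>carrier_vec d. 0 \<le> (A *\<^sub>v v) \<bullet>c v"
    then show "0 \<le> qform d A v" by (simp only: vec vec_carrier)
  next
    fix v :: "complex vec" assume "A \<in> carrier_mat d d" "\<forall>v. 0 \<le> qform d A v" "v \<in> carrier_vec d"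
    then show "0 \<le> (A *\<^sub>v v) \<bullet>c v" by (simp only: eq)
  qed
qed

lemma qform_ip: "qform d A v = ip d (\<lambda>a. \<Sum>b<d. A $$ (a, b) * v b) v"
  by (simp add: qform_def ip_def sum_distrib_right)

text \<open>Polarization: with \<open>e_a\<close>, \<open>e_b\<close> the standard unit vectors, the
  form is real on \<open>e_a + z e_b\<close>, and the choices
  \<open>z = 0, 1, -1, \<i>, -\<i>\<close> separate the real and imaginary parts of the two
  entries.\<close>

lemma psd_hermitian:
  assumes "psd d A" and a: "a < d" and b: "b < d"
  shows "A $$ (a, b) = cnj (A $$ (b, a))"
proof -
  have q: "qform d A (\<lambda>c. (if c = a then 1 else 0) + (if c = b then z else 0))
     = A $$ (a, a) + z * A $$ (a, b) + cnj z * A $$ (b, a) + z * cnj z * A $$ (b, b)" for z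
  proof -
    have "qform d A (\<lambda>c. (if c = a then 1 else 0) + (if c = b then z else 0))
      = (\<Sum>c<d. (A $$ (c, a) + A $$ (c, b) * z) * cnj ((if c = a then 1 else 0) + (if c = b then z else 0)))"
      unfolding qform_def
    proof (rule sum.cong[OF refl])
      fix c
      have "(\<Sum>e<d. A $$ (c, e) * ((if e = a then 1 else 0) + (if e = b then z else 0)))
        = (\<Sum>e<d. (if e = a then A $$ (c, e) else 0) + (if e = b then A $$ (c, e) * z else 0))"
        by (intro sum.cong) (auto simp: algebra_simps)
      also have "\<dots> = A $$ (c, a) + A $$ (c, b) * z" using a b by (simp add: sum.distrib)
      finally show "(\<Sum>e<d. A $$ (c, e) * ((if e = a then 1 else 0) + (if e = b then z else 0)) *
          cnj ((if c = a then 1 else 0) + (if c = b then z else 0)))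
        = (A $$ (c, a) + A $$ (c, b) * z) * cnj ((if c = a then 1 else 0) + (if c = b then z else 0))"
        by (simp add: sum_distrib_right[symmetric])
    qed
    also have "\<dots> = (\<Sum>c<d. (if c = a then A $$ (c, a) + A $$ (c, b) * z else 0)
        + (if c = b then (A $$ (c, a) + A $$ (c, b) * z) * cnj z else 0))"
      by (intro sum.cong) (auto simp: algebra_simps)
    also have "\<dots> = A $$ (a, a) + z * A $$ (a, b) + cnj z * A $$ (b, a) + z * cnj z * A $$ (b, b)"
      using a b by (simp add: sum.distrib algebra_simps)
    finally show ?thesis .
  qed
  have im: "Im (A $$ (a, a) + z * A $$ (a, b) + cnj z * A $$ (b, a) + z * cnj z * A $$ (b, b)) = 0" for z
  proof -
    have "0 \<le> qform d A (\<lambda>c. (if c = a then 1 else 0) + (if c = b then z else 0))"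
      using assms(1) by (simp add: psd_iff_qform)
    then show ?thesis unfolding q by (simp add: less_eq_complex_def)
  qed
  show ?thesis
    using im[of 0] im[of 1] im[of \<i>] im[of "-1"] im[of "-\<i>"] by (simp add: complex_eq_iff)
qed

text \<open>Induction on \<open>m\<close>: the compression of \<open>A\<close> to the orthogonal
  complement of the eigenvectors found so far has an eigenvector over the complex numbers. Since
  \<open>A\<close> is Hermitian, it maps this complement into itself, so that the eigenvector of the
  compression is one of \<open>A\<close>.\<close>

lemma hermitian_eigenvectors:
  fixes A :: "complex mat"
  assumes herm: "\<And>a b. a < d \<Longrightarrow> b < d \<Longrightarrow> A $$ (a, b) = cnj (A $$ (b, a))" and m: "m \<le> d"
  shows "\<exists>F. orthonormal d F \<and> card F = m \<and>
     (\<forall>f\<in>F. \<exists>\<mu>. \<forall>a<d. (\<Sum>b<d. A $$ (a, b) * f b) = \<mu> * f a)"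
  using m
proof (induction m)
  case 0
  show ?case by (intro exI[of _ "{}"]) (simp add: orthonormal_def)
next
  case (Suc m)
  define T where "T v = (\<lambda>a. \<Sum>b<d. A $$ (a, b) * v b)" for v
  have adj: "ip d (T u) v = ip d u (T v)" for u v
  proof -
    have "ip d (T u) v = (\<Sum>b<d. \<Sum>a<d. A $$ (a, b) * u b * cnj (v a))"
      unfolding ip_def T_def sum_distrib_right by (rule sum.swap)
    also have "\<dots> = ip d u (T v)"
      unfolding ip_def T_def cnj_sum sum_distrib_left complex_cnj_mult
    proof (intro sum.cong refl)
      fix a b assume "b \<in> {..<d}" "a \<in> {..<d}"
      then have "A $$ (a, b) = cnj (A $$ (b, a))" by (intro herm) auto
      then show "A $$ (a, b) * u b * cnj (v a) = u b * (cnj (A $$ (b, a)) * cnj (v a))"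
        by (simp only: mult_ac)
    qed
    finally show ?thesis .
  qed
  obtain F where F: "orthonormal d F" "card F = m"
      "\<And>f. f \<in> F \<Longrightarrow> \<exists>\<mu>. \<forall>a<d. T f a = \<mu> * f a"
    using Suc.IH[OF Suc_leD[OF Suc.prems]] unfolding T_def by blast
  obtain G where G: "orthonormal d G" "F \<subseteq> G" "card G = d" "\<And>v. in_span d G v"
    using orthonormal_extend[OF F(1)] by blast
  define n where "n = card (G - F)"
  have finG: "finite G" using G(1) by (rule orthonormal_finite)
  have n: "n > 0" using G F Suc.prems finG finite_subset[OF G(2) finG]
    unfolding n_def by (subst card_Diff_subset) auto
  obtain h where h: "bij_betw h {..<n} (G - F)"
    using ex_bij_betw_nat_finite[of "G - F"] finG unfolding n_def lessThan_atLeast0 by blast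
  define B where "B = mat n n (\<lambda>(i, j). ip d (T (h j)) (h i))"
  have "B \<in> carrier_mat n n" by (simp add: B_def)
  then have "spectrum B \<noteq> {}" using n by (rule spectrum_non_empty)
  then obtain k v where "eigenvector B v k" by (auto simp: spectrum_def eigenvalue_def)
  then have v: "v \<in> carrier_vec n" "v \<noteq> 0\<^sub>v n" "B *\<^sub>v v = k \<cdot>\<^sub>v v"
    by (auto simp: eigenvector_def B_def)
  define u where "u = (\<lambda>a. \<Sum>j<n. v $ j * h j a)"
  have hG: "h j \<in> G" "h j \<notin> F" if "j < n" for j
    using h that by (auto simp: bij_betw_def)
  have hij: "ip d (h j) (h i) = (if j = i then 1 else 0)" if "i < n" "j < n" for i j
    using orthonormalD[OF G(1) hG(1)[OF that(2)] hG(1)[OF that(1)]] h that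
    by (auto simp: bij_betw_def inj_on_def)
  have uh: "ip d u (h i) = v $ i" if "i < n" for i
  proof -
    have "ip d u (h i) = (\<Sum>j<n. if j = i then v $ j else 0)"
      unfolding u_def ip_sum_left using that by (intro sum.cong) (auto simp: hij)
    then show ?thesis using that by simp
  qed
  have uF: "ip d u f = 0" if "f \<in> F" for f
  proof -
    have "ip d (h j) f = 0" if "j < n" for j
      using orthonormalD[OF G(1) hG(1)[OF that], of f] hG(2)[OF that] \<open>f \<in> F\<close> G(2) by auto
    then show ?thesis unfolding u_def ip_sum_left by simp
  qed
  have Tlin: "T u a = (\<Sum>j<n. v $ j * T (h j) a)" for a
    unfolding T_def u_def sum_distrib_left by (subst sum.swap) (simp add: mult_ac)
  have Tuh: "ip d (T u) (h i) = k * v $ i" if i: "i < n" for i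
  proof -
    have "ip d (T u) (h i) = (\<Sum>j<n. v $ j * ip d (T (h j)) (h i))"
      unfolding ip_sum_left[symmetric] by (intro ip_cong) (simp_all add: Tlin)
    also have "\<dots> = (B *\<^sub>v v) $ i"
      using i v(1) by (simp add: B_def scalar_prod_def lessThan_atLeast0 mult.commute)
    also have "\<dots> = k * v $ i" using i v by simp
    finally show ?thesis .
  qed
  have TuF: "ip d (T u) f = 0" if f: "f \<in> F" for f
  proof -
    obtain \<mu> where "\<forall>a<d. T f a = \<mu> * f a" using F(3)[OF f] by blast
    then have "ip d u (T f) = ip d u (\<lambda>a. \<mu> * f a)" by (intro ip_cong) auto
    then show ?thesis by (simp add: adj ip_scale_right uF[OF f])
  qed
  \<comment> \<open>\<open>T u\<close> and \<open>k * u\<close> have the same coefficients along the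
    complete set \<open>G\<close>: along \<open>F\<close> both vanish, and along the
    \<open>h i\<close> they agree by the choice of \<open>v\<close>.\<close>
  have eq: "ip d (T u) g = k * ip d u g" if "g \<in> G" for g
  proof (cases "g \<in> F")
    case False
    then have "g \<in> h ` {..<n}" using h that by (simp add: bij_betw_def)
    then obtain i where "i < n" "g = h i" by auto
    then show ?thesis by (simp add: Tuh uh)
  qed (simp add: uF TuF)
  have Tu: "T u a = k * u a" if "a < d" for a
  proof -
    have "T u a = (\<Sum>g\<in>G. k * ip d u g * g a)"
      using G(4)[of "T u"] that by (simp add: in_span_def eq)
    also have "\<dots> = k * u a"
      using G(4)[of u] that by (simp add: in_span_def sum_distrib_left mult.assoc)
    finally show ?thesis .
  qed
  have "ip d u u \<noteq> 0"
  proof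
    assume "ip d u u = 0"
    then have "u a = 0" if "a < d" for a using that by (rule ip_self_eq_0D)
    then have "ip d u (h i) = 0" for i unfolding ip_def by (intro sum.neutral) auto
    then have "v = 0\<^sub>v n" using v(1) uh by (intro eq_vecI) auto
    then show False using v(2) by simp
  qed
  then obtain N where "N > 0" and nn: "ip d u u = complex_of_real (N\<^sup>2)"
    using ip_self_square by blast
  define g where "g = (\<lambda>a. complex_of_real (1 / N) * u a)"
  have gg: "ip d g g = 1"
    using \<open>N > 0\<close> unfolding g_def ip_scale_left ip_scale_right nn by (simp add: power2_eq_square)
  have gF: "ip d g f = 0" if "f \<in> F" for f
    unfolding g_def ip_scale_left by (simp add: uF[OF that])
  have Fg: "ip d f g = 0" if "f \<in> F" for f
    using gF[OF that] by (metis cnj_ip complex_cnj_zero)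
  have gnF: "g \<notin> F" using gF gg by force
  have "orthonormal d (insert g F)"
    using F(1) gg gF Fg gnF by (auto simp: orthonormal_def)
  moreover have "card (insert g F) = Suc m"
    using gnF F(2) orthonormal_finite[OF F(1)] by simp
  moreover have "\<exists>\<mu>. \<forall>a<d. T g a = \<mu> * g a"
  proof (intro exI[of _ k] allI impI)
    fix a assume "a < d"
    have "T g a = complex_of_real (1 / N) * T u a"
      unfolding T_def g_def by (simp add: sum_distrib_left mult_ac)
    then show "T g a = k * g a" using Tu[OF \<open>a < d\<close>] by (simp add: g_def)
  qed
  ultimately show ?case using F(3) unfolding T_def
    by (intro exI[of _ "insert g F"] conjI ballI) (auto simp only: insert_iff)
qed

text \<open>The entrywise form of \<open>A = \<Sum>k. e k |x k><x k|\<close> reduces traces and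
  quadratic forms to finite sums; the sign of \<open>e\<close> is left open.\<close>

definition eigdec :: "nat \<Rightarrow> complex mat \<Rightarrow> (nat \<Rightarrow> nat \<Rightarrow> complex) \<Rightarrow> (nat \<Rightarrow> real) \<Rightarrow> bool" where
  "eigdec d A x e \<longleftrightarrow> A \<in> carrier_mat d d \<and> onb d x \<and>
     (\<forall>a<d. \<forall>b<d. A $$ (a, b) = (\<Sum>k<d. complex_of_real (e k) * x k a * cnj (x k b)))"

text \<open>A set of \<open>d\<close> orthonormal eigenvectors is already complete, by cardinality.
  Each eigenvalue is the value of the quadratic form at its unit eigenvector, hence real and
  nonnegative.\<close>

lemma psd_eigdec:
  assumes A: "psd d A"
  shows "\<exists>x e. eigdec d A x e \<and> (\<forall>k<d. 0 \<le> e k)"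
proof -
  obtain F where F: "orthonormal d F" "card F = d"
      "\<And>f. f \<in> F \<Longrightarrow> \<exists>\<mu>. \<forall>a<d. (\<Sum>b<d. A $$ (a, b) * f b) = \<mu> * f a"
    using hermitian_eigenvectors[OF psd_hermitian[OF A] order_refl] by blast
  obtain G where G: "orthonormal d G" "F \<subseteq> G" "card G = d"
      "\<And>a b. a < d \<Longrightarrow> b < d \<Longrightarrow> (\<Sum>f\<in>G. f a * cnj (f b)) = (if a = b then 1 else 0)"
    using orthonormal_extend[OF F(1)] by blast
  have "F = G" using G F by (intro card_subset_eq orthonormal_finite) auto
  obtain x where x: "bij_betw x {..<d} F"
    using ex_bij_betw_nat_finite[OF orthonormal_finite[OF F(1)]] unfolding F(2) lessThan_atLeast0 by blast
  have xF: "x k \<in> F" if "k < d" for k using x that by (auto simp: bij_betw_def)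
  have reindex: "(\<Sum>k<d. x k a * cnj (x k b)) = (if a = b then 1 else 0)" if "a < d" "b < d" for a b
    using sum.reindex_bij_betw[OF x, of "\<lambda>f. f a * cnj (f b)"] G(4)[OF that] \<open>F = G\<close> by simp
  have onb: "onb d x"
    unfolding onb_def
  proof (intro conjI allI impI)
    fix k l assume kl: "k < d" "l < d"
    have "x k = x l \<longleftrightarrow> k = l" using x kl by (auto simp: bij_betw_def inj_on_def)
    then show "ip d (x k) (x l) = (if k = l then 1 else 0)"
      using orthonormalD[OF F(1) xF[OF kl(1)] xF[OF kl(2)]] by simp
  qed (simp add: reindex)
  define e where "e k = Re (qform d A (x k))" for k
  have q: "0 \<le> qform d A v" for v using A by (simp add: psd_iff_qform)
  have ev: "(\<Sum>b<d. A $$ (a, b) * x k b) = complex_of_real (e k) * x k a" if ka: "k < d" "a < d" for k a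
  proof -
    obtain \<mu> where \<mu>: "\<forall>a<d. (\<Sum>b<d. A $$ (a, b) * x k b) = \<mu> * x k a" using F(3)[OF xF[OF ka(1)]] by blast
    have "qform d A (x k) = ip d (\<lambda>a. \<mu> * x k a) (x k)"
      unfolding qform_ip using \<mu> by (intro ip_cong) auto
    also have "\<dots> = \<mu>" unfolding ip_scale_left using onb ka by (simp add: onb_def)
    finally have "\<mu> = complex_of_real (e k)"
      using q[of "x k"] by (simp add: e_def complex_eq_iff less_eq_complex_def)
    then show ?thesis using \<mu> ka by simp
  qed
  have "A $$ (a, b) = (\<Sum>k<d. complex_of_real (e k) * x k a * cnj (x k b))" if "a < d" "b < d" for a b
  proof -
    have "(\<Sum>k<d. complex_of_real (e k) * x k a * cnj (x k b))
        = (\<Sum>k<d. \<Sum>c<d. A $$ (a, c) * (x k c * cnj (x k b)))"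
      using that by (intro sum.cong refl) (simp add: ev[symmetric] sum_distrib_right mult.assoc)
    also have "\<dots> = (\<Sum>c<d. A $$ (a, c) * (\<Sum>k<d. x k c * cnj (x k b)))"
      by (subst sum.swap) (simp add: sum_distrib_left)
    also have "\<dots> = (\<Sum>c<d. if c = b then A $$ (a, c) else 0)"
      using that by (intro sum.cong) (auto simp: reindex)
    finally show ?thesis using that by simp
  qed
  then have "eigdec d A x e" using onb A by (simp add: eigdec_def psd_def)
  moreover have "0 \<le> e k" for k using q by (simp add: e_def less_eq_complex_def)
  ultimately show ?thesis by blast
qed

section \<open>Bounds on the optimal error\<close>

lemma eigdec_entry:
  "eigdec d A x e \<Longrightarrow> a < d \<Longrightarrow> b < d \<Longrightarrow>
     A $$ (a, b) = (\<Sum>k<d. complex_of_real (e k) * x k a * cnj (x k b))"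
  by (simp add: eigdec_def)

lemma qform_eigdec:
  assumes "eigdec d A x e"
  shows "qform d A v = complex_of_real (\<Sum>k<d. e k * (cmod (ip d v (x k)))\<^sup>2)"
proof -
  have "qform d A v = (\<Sum>a<d. \<Sum>b<d. \<Sum>k<d. complex_of_real (e k) * ((x k a * cnj (v a)) * (v b * cnj (x k b))))"
    unfolding qform_def
    by (intro sum.cong refl) (simp add: eigdec_entry[OF assms] sum_distrib_left sum_distrib_right mult_ac)
  also have "\<dots> = (\<Sum>k<d. complex_of_real (e k) * (ip d (x k) v * ip d v (x k)))"
  proof -
    have "(\<Sum>a<d. \<Sum>b<d. \<Sum>k<d. complex_of_real (e k) * ((x k a * cnj (v a)) * (v b * cnj (x k b))))
      = (\<Sum>a<d. \<Sum>k<d. \<Sum>b<d. complex_of_real (e k) * ((x k a * cnj (v a)) * (v b * cnj (x k b))))"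
      by (rule sum.cong[OF refl], rule sum.swap)
    also have "\<dots> = (\<Sum>k<d. \<Sum>a<d. \<Sum>b<d. complex_of_real (e k) * ((x k a * cnj (v a)) * (v b * cnj (x k b))))"
      by (rule sum.swap)
    finally show ?thesis unfolding ip_def sum_product unfolding sum_distrib_left .
  qed
  finally show ?thesis by (simp add: ip_mult_commute cmod_ip_commute)
qed

lemma trace_mult_eigdec:
  assumes A: "eigdec d A x e" and B: "B \<in> carrier_mat d d"
  shows "mat_trace (A * B) = (\<Sum>k<d. complex_of_real (e k) * qform d B (x k))"
proof -
  have "mat_trace (A * B) = (\<Sum>a<d. \<Sum>b<d. A $$ (a, b) * B $$ (b, a))"
    using A B by (auto simp: eigdec_def mat_trace_def scalar_prod_def lessThan_atLeast0 intro!: sum.cong)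
  also have "\<dots> = (\<Sum>a<d. \<Sum>b<d. \<Sum>k<d. complex_of_real (e k) * (B $$ (b, a) * x k a * cnj (x k b)))"
    by (intro sum.cong refl) (simp add: eigdec_entry[OF A] sum_distrib_left sum_distrib_right mult_ac)
  also have "\<dots> = (\<Sum>k<d. \<Sum>b<d. \<Sum>a<d. complex_of_real (e k) * (B $$ (b, a) * x k a * cnj (x k b)))"
    by (subst sum.swap, subst (2) sum.swap, subst sum.swap) (rule refl)
  finally show ?thesis by (simp add: qform_def sum_distrib_left)
qed

lemma qform_one: "qform d (1\<^sub>m d) v = ip d v v"
proof -
  have "(\<Sum>b<d. 1\<^sub>m d $$ (a, b) * v b * cnj (v a)) = (\<Sum>b<d. if a = b then v b * cnj (v a) else 0)"
    if "a < d" for a using that by (intro sum.cong) auto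
  then show ?thesis by (simp add: qform_def ip_def)
qed

lemma qform_minus:
  "A \<in> carrier_mat d d \<Longrightarrow> B \<in> carrier_mat d d \<Longrightarrow> qform d (A - B) v = qform d A v - qform d B v"
  by (simp add: qform_def algebra_simps sum_subtractf)

lemma mat_sum_carrier [simp]: "mat_sum d I F \<in> carrier_mat d d"
  by (simp add: mat_sum_def)

lemma qform_mat_sum: "qform d (mat_sum d I F) v = (\<Sum>i\<in>I. qform d (F i) v)"
proof -
  have "qform d (mat_sum d I F) v = (\<Sum>a<d. \<Sum>b<d. \<Sum>i\<in>I. F i $$ (a, b) * v b * cnj (v a))"
    by (simp add: qform_def mat_sum_def sum_distrib_right)
  also have "\<dots> = (\<Sum>a<d. \<Sum>i\<in>I. \<Sum>b<d. F i $$ (a, b) * v b * cnj (v a))"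
    by (rule sum.cong[OF refl], rule sum.swap)
  also have "\<dots> = (\<Sum>i\<in>I. qform d (F i) v)" unfolding qform_def by (rule sum.swap)
  finally show ?thesis .
qed

section \<open>POVM elements and the infimum in the optimal error\<close>

lemma povm_qform:
  assumes "povm d m E"
  shows "i < m \<Longrightarrow> 0 \<le> Re (qform d (E i) v)" and "(\<Sum>i<m. Re (qform d (E i) v)) \<le> Re (ip d v v)"
proof -
  show "0 \<le> Re (qform d (E i) v)" if "i < m"
    using assms that by (simp add: povm_def psd_iff_qform less_eq_complex_def)
  have "0 \<le> qform d (1\<^sub>m d - mat_sum d {..<m} E) v" using assms by (simp add: povm_def psd_iff_qform)
  then show "(\<Sum>i<m. Re (qform d (E i) v)) \<le> Re (ip d v v)"
    by (simp add: qform_minus qform_one qform_mat_sum less_eq_complex_def)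
qed

lemma povm_le_one:
  assumes "povm d m E" "i < m"
  shows "Re (qform d (E i) v) \<le> Re (ip d v v)"
proof -
  have "Re (qform d (E i) v) \<le> (\<Sum>i<m. Re (qform d (E i) v))"
    using povm_qform(1)[OF assms(1)] assms(2) by (intro member_le_sum) auto
  then show ?thesis using povm_qform(2)[OF assms(1), of v] by linarith
qed

lemma povm_carrier: "povm d m E \<Longrightarrow> i < m \<Longrightarrow> E i \<in> carrier_mat d d"
  by (simp add: povm_def psd_def)

lemma error_term_eigdec:
  assumes A: "eigdec d A x e" and E: "E \<in> carrier_mat d d"
  shows "Re (mat_trace (A * (1\<^sub>m d - E))) = (\<Sum>k<d. e k * (1 - Re (qform d E (x k))))"
proof -
  have "qform d (1\<^sub>m d - E) (x k) = 1 - qform d E (x k)" if "k < d" for k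
    using A that E by (simp add: eigdec_def onb_def qform_minus qform_one)
  then show ?thesis
    unfolding trace_mult_eigdec[OF A minus_carrier_mat[OF E]] by simp
qed

lemma error_term_nonneg:
  assumes A: "psd d A" and E: "povm d m E" and i: "i < m"
  shows "0 \<le> Re (mat_trace (A * (1\<^sub>m d - E i)))"
proof -
  obtain x e where xe: "eigdec d A x e" "\<forall>k<d. 0 \<le> e k" using psd_eigdec[OF A] by blast
  have "Re (qform d (E i) (x k)) \<le> 1" if "k < d" for k
    using povm_le_one[OF E i, of "x k"] xe(1) that by (simp add: eigdec_def onb_def)
  then show ?thesis using xe(2)
    by (auto simp: error_term_eigdec[OF xe(1) povm_carrier[OF E i]] intro!: sum_nonneg mult_nonneg_nonneg)
qed

lemma opt_err_le:
  assumes "\<And>i. i < length As \<Longrightarrow> psd d (As ! i)" and "povm d (length As) E"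
  shows "opt_err d As \<le> (\<Sum>i<length As. Re (mat_trace (As ! i * (1\<^sub>m d - E i))))"
  unfolding opt_err_def
proof (rule cInf_lower)
  show "bdd_below {\<Sum>i<length As. Re (mat_trace (As ! i * (1\<^sub>m d - E i))) |E. povm d (length As) E}"
    using assms(1) by (auto intro!: bdd_belowI[of _ 0] sum_nonneg error_term_nonneg)
qed (use assms in blast)

text \<open>The measurement that never decides: it shows that the set of errors is nonempty, and its
  error is the sum of the traces.\<close>

lemma povm_zero: "povm d m (\<lambda>_. 0\<^sub>m d d)"
proof -
  have "mat_sum d {..<m} (\<lambda>_. 0\<^sub>m d d) = 0\<^sub>m d d" by (auto simp: mat_sum_def)
  moreover have "qform d (0\<^sub>m d d) v = 0" for v by (simp add: qform_def)
  moreover have "0 \<le> ip d v v" for v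
    using ip_self_nonneg[of d v] ip_self_Re[of d v] by (simp add: less_eq_complex_def complex_eq_iff)
  ultimately show ?thesis
    by (simp add: povm_def psd_iff_qform qform_minus qform_one minus_carrier_mat)
qed

lemma opt_err_greatest:
  assumes "\<And>E. povm d (length As) E \<Longrightarrow> c \<le> (\<Sum>i<length As. Re (mat_trace (As ! i * (1\<^sub>m d - E i))))"
  shows "c \<le> opt_err d As"
  unfolding opt_err_def using assms povm_zero by (intro cInf_greatest) blast+

text \<open>For \<open>T = \<Sum>j. c j |z j\<rangle>\<langle>z j|\<close> with \<open>0 \<le> T \<le> 1\<close>, this is \<open>\<langle>v, T\<^sup>2 v\<rangle> \<le> \<langle>v, T v\<rangle>\<close>.\<close>

lemma contraction_square_le:
  assumes z: "onb d z" and y: "onb d y" and c: "\<And>j. j < d \<Longrightarrow> 0 \<le> c j \<and> c j \<le> 1"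
  shows "(\<Sum>l<d. (cmod (\<Sum>j<d. complex_of_real (c j) * (ip d v (z j) * ip d (z j) (y l))))\<^sup>2)
    \<le> (\<Sum>j<d. c j * (cmod (ip d v (z j)))\<^sup>2)"
proof -
  define g where "g = (\<lambda>a. \<Sum>j<d. (complex_of_real (c j) * ip d v (z j)) * z j a)"
  have gz: "ip d g u = (\<Sum>j<d. complex_of_real (c j) * (ip d v (z j) * ip d (z j) u))" for u
    unfolding g_def ip_sum_left by (simp add: mult.assoc)
  have gzk: "ip d g (z k) = complex_of_real (c k) * ip d v (z k)" if "k < d" for k
  proof -
    have "ip d g (z k) = (\<Sum>j<d. if j = k then complex_of_real (c j) * ip d v (z j) else 0)"
      unfolding gz using z that by (intro sum.cong) (auto simp: onb_def)
    then show ?thesis using that by simp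
  qed
  have "(\<Sum>l<d. (cmod (\<Sum>j<d. complex_of_real (c j) * (ip d v (z j) * ip d (z j) (y l))))\<^sup>2)
      = (\<Sum>l<d. (cmod (ip d (y l) g))\<^sup>2)"
    by (simp add: gz[symmetric] cmod_ip_commute)
  also have "\<dots> = Re (ip d g g)" by (rule onb_parseval_norm[OF y])
  also have "\<dots> = (\<Sum>j<d. (cmod (ip d (z j) g))\<^sup>2)" by (rule onb_parseval_norm[OF z, symmetric])
  also have "\<dots> = (\<Sum>j<d. (cmod (ip d g (z j)))\<^sup>2)" by (simp add: cmod_ip_commute)
  also have "\<dots> = (\<Sum>j<d. (c j)\<^sup>2 * (cmod (ip d v (z j)))\<^sup>2)"
    by (intro sum.cong refl) (simp add: gzk norm_mult power_mult_distrib)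
  also have "\<dots> \<le> (\<Sum>j<d. c j * (cmod (ip d v (z j)))\<^sup>2)"
    using c by (intro sum_mono mult_right_mono) (auto simp: power2_eq_square mult_left_le)
  finally show ?thesis .
qed

text \<open>With \<open>T = E 0\<close>, every inner product splits as \<open>s + t\<close> with
  \<open>s = <T x, y>\<close> and \<open>t = <(1 - T) x, y>\<close>, and
  \<open>|s + t|^2 \<le> 2 (|s|^2 + |t|^2)\<close>. Then \<open>T^2 \<le> T\<close>,
  \<open>(1 - T)^2 \<le> 1 - T\<close> and \<open>T \<le> 1 - E 1\<close> bound the sums of
  \<open>|s|^2\<close> and \<open>|t|^2\<close> by the two error terms.\<close>

lemma overlap_le_opt_err:
  assumes A: "eigdec d A x e" and B: "eigdec d B y f"
    and e: "\<And>k. k < d \<Longrightarrow> 0 \<le> e k" and f: "\<And>l. l < d \<Longrightarrow> 0 \<le> f l"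
  shows "overlap d e x f y \<le> 2 * opt_err d [A, B]"
proof -
  have "overlap d e x f y / 2 \<le> opt_err d [A, B]"
  proof (rule opt_err_greatest)
    fix E assume "povm d (length [A, B]) E"
    then have E: "povm d 2 E" by (simp add: numeral_2_eq_2)
    have E0: "psd d (E 0)" using E by (simp add: povm_def)
    obtain z c where zc: "eigdec d (E 0) z c" "\<forall>j<d. 0 \<le> c j" using psd_eigdec[OF E0] by blast
    have z: "onb d z" and x: "onb d x" and y: "onb d y"
      using zc A B by (simp_all add: eigdec_def)
    have q: "Re (qform d (E 0) v) = (\<Sum>j<d. c j * (cmod (ip d v (z j)))\<^sup>2)" for v
      by (simp add: qform_eigdec[OF zc(1)])
    have c1: "c j \<le> 1" if j: "j < d" for j
    proof -
      have "Re (qform d (E 0) (z j)) = (\<Sum>i<d. if i = j then c i else 0)"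
        unfolding q using z j by (intro sum.cong) (auto simp: onb_def)
      then have "Re (qform d (E 0) (z j)) = c j" using j by simp
      then show ?thesis using povm_le_one[OF E, of 0 "z j"] z j by (simp add: onb_def)
    qed
    define t where "t k l = (\<Sum>j<d. complex_of_real (1 - c j) * (ip d (x k) (z j) * ip d (z j) (y l)))" for k l
    define s where "s k l = (\<Sum>j<d. complex_of_real (c j) * (ip d (x k) (z j) * ip d (z j) (y l)))" for k l
    have st: "s k l + t k l = ip d (x k) (y l)" for k l
    proof -
      have "s k l + t k l = (\<Sum>j<d. ip d (x k) (z j) * ip d (z j) (y l))"
        unfolding s_def t_def sum.distrib[symmetric] by (intro sum.cong refl) (simp add: algebra_simps)
      then show ?thesis by (simp only: onb_parseval[OF z])
    qed
    have tk: "(\<Sum>l<d. (cmod (t k l))\<^sup>2) \<le> 1 - Re (qform d (E 0) (x k))" if k: "k < d" for k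
    proof -
      have "(\<Sum>l<d. (cmod (t k l))\<^sup>2) \<le> (\<Sum>j<d. (1 - c j) * (cmod (ip d (x k) (z j)))\<^sup>2)"
        unfolding t_def using zc(2) c1 by (intro contraction_square_le z y) auto
      also have "\<dots> = (\<Sum>j<d. (cmod (ip d (z j) (x k)))\<^sup>2) - Re (qform d (E 0) (x k))"
        by (simp add: q left_diff_distrib sum_subtractf cmod_ip_commute)
      also have "(\<Sum>j<d. (cmod (ip d (z j) (x k)))\<^sup>2) = 1"
        using x k by (simp add: onb_parseval_norm[OF z] onb_def)
      finally show ?thesis .
    qed
    \<comment> \<open>Up to conjugation \<open>s k l\<close> is also \<open><T y, x>\<close>, so the
      sum over \<open>k\<close> falls under the contraction bound at \<open>y l\<close>.\<close>
    have sl: "(\<Sum>k<d. (cmod (s k l))\<^sup>2) \<le> 1 - Re (qform d (E 1) (y l))" if l: "l < d" for l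
    proof -
      have "cmod (s k l) = cmod (\<Sum>j<d. complex_of_real (c j) * (ip d (y l) (z j) * ip d (z j) (x k)))" for k
      proof -
        have "cnj (s k l) = (\<Sum>j<d. complex_of_real (c j) * (ip d (y l) (z j) * ip d (z j) (x k)))"
          by (simp add: s_def cnj_ip mult_ac)
        then show ?thesis by (metis complex_mod_cnj)
      qed
      then have "(\<Sum>k<d. (cmod (s k l))\<^sup>2) \<le> Re (qform d (E 0) (y l))"
        unfolding q using zc(2) c1 contraction_square_le[OF z x, of c "y l"] by simp
      also have "\<dots> \<le> 1 - Re (qform d (E 1) (y l))"
        using povm_qform(2)[OF E, of "y l"] y l by (simp add: numeral_2_eq_2 onb_def)
      finally show ?thesis .
    qed
    have "overlap d e x f y / 2 \<le> (\<Sum>k<d. \<Sum>l<d. e k * (cmod (t k l))\<^sup>2 + f l * (cmod (s k l))\<^sup>2)"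
      unfolding overlap_def sum_divide_distrib
    proof (intro sum_mono)
      fix k l assume "k \<in> {..<d}" "l \<in> {..<d}"
      then have kl: "0 \<le> e k" "0 \<le> f l" using e f by auto
      have "(cmod (ip d (x k) (y l)))\<^sup>2 \<le> (cmod (s k l) + cmod (t k l))\<^sup>2"
        unfolding st[symmetric] by (intro power_mono norm_triangle_ineq) auto
      also have "\<dots> \<le> 2 * ((cmod (t k l))\<^sup>2 + (cmod (s k l))\<^sup>2)"
        using sum_squares_bound[of "cmod (s k l)" "cmod (t k l)"] by (simp add: power2_sum)
      finally have "min (e k) (f l) * (cmod (ip d (x k) (y l)))\<^sup>2
          \<le> min (e k) (f l) * (2 * ((cmod (t k l))\<^sup>2 + (cmod (s k l))\<^sup>2))"
        using kl by (intro mult_left_mono) auto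
      also have "\<dots> = 2 * (min (e k) (f l) * (cmod (t k l))\<^sup>2 + min (e k) (f l) * (cmod (s k l))\<^sup>2)"
        by (simp add: algebra_simps)
      also have "\<dots> \<le> 2 * (e k * (cmod (t k l))\<^sup>2 + f l * (cmod (s k l))\<^sup>2)"
        by (intro mult_left_mono add_mono mult_right_mono) auto
      finally show "min (e k) (f l) * (cmod (ip d (x k) (y l)))\<^sup>2 / 2
          \<le> e k * (cmod (t k l))\<^sup>2 + f l * (cmod (s k l))\<^sup>2" by simp
    qed
    also have "\<dots> = (\<Sum>k<d. e k * (\<Sum>l<d. (cmod (t k l))\<^sup>2)) + (\<Sum>l<d. f l * (\<Sum>k<d. (cmod (s k l))\<^sup>2))"
      unfolding sum.distrib sum_distrib_left
      by (rule arg_cong[where f = "(+) _"]) (rule sum.swap)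
    also have "\<dots> \<le> (\<Sum>k<d. e k * (1 - Re (qform d (E 0) (x k)))) + (\<Sum>l<d. f l * (1 - Re (qform d (E 1) (y l))))"
      using e f tk sl by (intro add_mono sum_mono mult_left_mono) auto
    also have "\<dots> = (\<Sum>i<length [A, B]. Re (mat_trace ([A, B] ! i * (1\<^sub>m d - E i))))"
      using error_term_eigdec[OF A povm_carrier[OF E]] error_term_eigdec[OF B povm_carrier[OF E]]
      by simp
    finally show "overlap d e x f y / 2 \<le> \<dots>" .
  qed
  then show ?thesis by simp
qed

section \<open>Upper bounds on the optimal error by pairwise quantities\<close>

lemma overlap_commute: "overlap d e x f y = overlap d f y e x"
  unfolding overlap_def by (subst sum.swap) (simp add: min.commute cmod_ip_commute)

text \<open>\<open>E i\<close> is the projection onto the span of \<open>G i\<close>. Bessel's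
  inequality for the disjoint union of the \<open>G i\<close> says that these projections sum to at
  most the identity.\<close>

theorem opt_err_le_overlaps:
  assumes len: "0 < length As"
    and dec: "\<And>i. i < length As \<Longrightarrow> eigdec d (As ! i) (x i) (e i)"
    and e: "\<And>i k. i < length As \<Longrightarrow> k < d \<Longrightarrow> 0 \<le> e i k"
    and psd: "\<And>i. i < length As \<Longrightarrow> psd d (As ! i)"
  shows "opt_err d As \<le> 4 * (real (length As) + 1) *
    (\<Sum>i<length As. \<Sum>j\<in>{..<length As} - {i}. overlap d (e i) (x i) (e j) (x j))"
proof -
  let ?r = "length As"
  have onb: "onb d (x i)" if "i < ?r" for i using dec[OF that] by (simp add: eigdec_def)
  obtain G where G: "orthonormal d (\<Union>i<?r. G i)" "\<forall>i<?r. \<forall>j<?r. i \<noteq> j \<longrightarrow> G i \<inter> G j = {}"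
    and bound: "(\<Sum>i<?r. \<Sum>k<d. e i k * (1 - (\<Sum>f\<in>G i. (cmod (ip d (x i k) f))\<^sup>2)))
      \<le> 4 * (real ?r + 1) * (\<Sum>i<?r. \<Sum>j\<in>{..<?r} - {i}. overlap d (e i) (x i) (e j) (x j))"
    using flag_measurement[where r = ?r and d = d and x = x and e = e, OF len onb e] by blast
  define E where "E i = mat d d (\<lambda>(a, b). \<Sum>f\<in>G i. f a * cnj (f b))" for i
  have qE: "qform d (E i) v = complex_of_real (\<Sum>f\<in>G i. (cmod (ip d v f))\<^sup>2)" for i v
  proof -
    have "qform d (E i) v = (\<Sum>a<d. \<Sum>b<d. \<Sum>f\<in>G i. (v b * cnj (f b)) * (f a * cnj (v a)))"
      by (simp add: qform_def E_def sum_distrib_left sum_distrib_right mult_ac)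
    also have "\<dots> = (\<Sum>a<d. \<Sum>f\<in>G i. \<Sum>b<d. (v b * cnj (f b)) * (f a * cnj (v a)))"
      by (rule sum.cong[OF refl], rule sum.swap)
    also have "\<dots> = (\<Sum>f\<in>G i. \<Sum>a<d. \<Sum>b<d. (v b * cnj (f b)) * (f a * cnj (v a)))"
      by (rule sum.swap)
    also have "\<dots> = (\<Sum>f\<in>G i. ip d v f * ip d f v)"
      unfolding ip_def sum_product by (rule sum.cong[OF refl], rule sum.swap)
    finally show ?thesis by (simp add: ip_mult_commute)
  qed
  have Ec: "E i \<in> carrier_mat d d" for i by (simp add: E_def)
  have povm: "povm d ?r E"
    unfolding povm_def psd_iff_qform
  proof (intro conjI allI impI)
    show "0 \<le> qform d (E i) v" for i v
      unfolding qE by (simp add: less_eq_complex_def sum_nonneg)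
    fix v
    have "(\<Sum>i<?r. \<Sum>f\<in>G i. (cmod (ip d v f))\<^sup>2) = (\<Sum>f\<in>(\<Union>i<?r. G i). (cmod (ip d v f))\<^sup>2)"
      using G orthonormal_finite[OF G(1)] by (intro sum.UNION_disjoint[symmetric]) auto
    also have "\<dots> \<le> Re (ip d v v)" by (rule orthonormal_bessel[OF G(1)])
    finally have "0 \<le> complex_of_real (Re (ip d v v) - (\<Sum>i<?r. \<Sum>f\<in>G i. (cmod (ip d v f))\<^sup>2))"
      by (simp add: less_eq_complex_def)
    also have "\<dots> = qform d (1\<^sub>m d - mat_sum d {..<?r} E) v"
      using ip_self_Re[of d v] by (simp add: qform_minus qform_one qform_mat_sum qE)
    finally show "0 \<le> qform d (1\<^sub>m d - mat_sum d {..<?r} E) v" .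
  qed (auto simp: Ec minus_carrier_mat)
  have "opt_err d As \<le> (\<Sum>i<?r. Re (mat_trace (As ! i * (1\<^sub>m d - E i))))"
    using psd povm by (rule opt_err_le)
  also have "\<dots> = (\<Sum>i<?r. \<Sum>k<d. e i k * (1 - (\<Sum>f\<in>G i. (cmod (ip d (x i k) f))\<^sup>2)))"
    by (intro sum.cong refl) (simp add: error_term_eigdec[OF dec Ec] qE)
  finally show ?thesis using bound by linarith
qed

text \<open>The case of two hypotheses: \<open>24 = 4 * 3 * 2\<close>, the last factor counting both
  orders of the pair.\<close>

lemma opt_err_pair_le_overlap:
  assumes A: "eigdec d A x e" and B: "eigdec d B y f"
    and e: "\<And>k. k < d \<Longrightarrow> 0 \<le> e k" and f: "\<And>l. l < d \<Longrightarrow> 0 \<le> f l"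
    and psd: "psd d A" "psd d B"
  shows "opt_err d [A, B] \<le> 24 * overlap d e x f y"
proof -
  have "opt_err d [A, B] \<le> 4 * (real (length [A, B]) + 1) *
    (\<Sum>i<length [A, B]. \<Sum>j\<in>{..<length [A, B]} - {i}. overlap d ([e, f] ! i) ([x, y] ! i) ([e, f] ! j) ([x, y] ! j))"
    using assms by (intro opt_err_le_overlaps) (auto simp: less_Suc_eq)
  also have "\<dots> = 12 * (overlap d e x f y + overlap d f y e x)"
  proof -
    have "{..<2::nat} - {0} = {1}" "{..<2::nat} - {1} = {0}" by auto
    then show ?thesis by (simp add: numeral_2_eq_2)
  qed
  finally show ?thesis by (simp add: overlap_commute[of d f])
qed

theorem opt_err_le_pairs:
  assumes len: "0 < length As" and psd: "\<And>i. i < length As \<Longrightarrow> psd d (As ! i)"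
  shows "opt_err d As \<le> 8 * (real (length As) + 1) *
    (\<Sum>i<length As. \<Sum>j\<in>{..<length As} - {i}. opt_err d [As ! i, As ! j])"
proof -
  have "\<forall>i<length As. \<exists>x e. eigdec d (As ! i) x e \<and> (\<forall>k<d. 0 \<le> e k)"
    using psd psd_eigdec by blast
  then obtain x e where xe: "\<And>i. i < length As \<Longrightarrow> eigdec d (As ! i) (x i) (e i)"
    "\<And>i k. i < length As \<Longrightarrow> k < d \<Longrightarrow> 0 \<le> e i k" by metis
  have "opt_err d As \<le> 4 * (real (length As) + 1) *
    (\<Sum>i<length As. \<Sum>j\<in>{..<length As} - {i}. overlap d (e i) (x i) (e j) (x j))"
    by (rule opt_err_le_overlaps[OF len xe psd])
  also have "\<dots> \<le> 4 * (real (length As) + 1) *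
    (\<Sum>i<length As. \<Sum>j\<in>{..<length As} - {i}. 2 * opt_err d [As ! i, As ! j])"
    using xe by (intro mult_left_mono sum_mono overlap_le_opt_err) auto
  also have "\<dots> = 8 * (real (length As) + 1) *
    (\<Sum>i<length As. \<Sum>j\<in>{..<length As} - {i}. opt_err d [As ! i, As ! j])"
    unfolding sum_distrib_left[symmetric] by simp
  finally show ?thesis .
qed

text \<open>The symmetric quantity \<open>overlap\<close> is comparable to the optimal error from
  both sides, with \<open>48 = 24 * 2\<close>. A constant factor does not affect exponents.\<close>

lemma opt_err_pair_commute_le:
  assumes "psd d A" "psd d B"
  shows "opt_err d [B, A] \<le> 48 * opt_err d [A, B]"
proof -
  obtain x e where A: "eigdec d A x e" "\<forall>k<d. 0 \<le> e k" using psd_eigdec[OF assms(1)] by blast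
  obtain y f where B: "eigdec d B y f" "\<forall>k<d. 0 \<le> f k" using psd_eigdec[OF assms(2)] by blast
  have "opt_err d [B, A] \<le> 24 * overlap d f y e x"
    using A B assms by (intro opt_err_pair_le_overlap) auto
  also have "overlap d f y e x = overlap d e x f y" by (rule overlap_commute)
  also have "\<dots> \<le> 2 * opt_err d [A, B]" using A B by (intro overlap_le_opt_err) auto
  finally show ?thesis by simp
qed

section \<open>Powers of operators and the Chernoff quantity\<close>

lemma mat_adjoint_index:
  "U \<in> carrier_mat d d \<Longrightarrow> i < d \<Longrightarrow> j < d \<Longrightarrow> mat_adjoint U $$ (i, j) = cnj (U $$ (j, i))"
  by (auto simp: mat_adjoint_def mat_of_rows_def)

text \<open>The matrix \<open>U\<close> with columns \<open>x k\<close> is unitary and diagonalizes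
  \<open>A\<close>, so \<open>psd_powr_eqI\<close> evaluates the power in this basis.\<close>

lemma eigdec_psd_powr:
  assumes A: "eigdec d A x e"
  shows "eigdec d (psd_powr d A s) x (\<lambda>k. e k powr s)"
proof -
  define U where "U = mat d d (\<lambda>(a, k). x k a)"
  have Uc: "U \<in> carrier_mat d d" and U'c: "mat_adjoint U \<in> carrier_mat d d"
    by (simp_all add: U_def mat_adjoint_carrier)
  have Ue: "U $$ (a, k) = x k a" if "a < d" "k < d" for a k
    using that by (simp add: U_def)
  have U': "mat_adjoint U $$ (k, a) = cnj (x k a)" if "k < d" "a < d" for k a
    unfolding mat_adjoint_index[OF Uc that] using that by (simp add: Ue)
  have onb: "onb d x" using A by (simp add: eigdec_def)
  have "U * mat_adjoint U = 1\<^sub>m d"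
  proof (rule eq_matI)
    fix a b assume "a < dim_row (1\<^sub>m d :: complex mat)" "b < dim_col (1\<^sub>m d :: complex mat)"
    then have ab: "a < d" "b < d" by auto
    have "(U * mat_adjoint U) $$ (a, b) = (\<Sum>k<d. x k a * cnj (x k b))"
      using Uc U'c ab by (auto simp: scalar_prod_def lessThan_atLeast0 U' Ue intro!: sum.cong)
    then show "(U * mat_adjoint U) $$ (a, b) = 1\<^sub>m d $$ (a, b)" using onb ab by (simp add: onb_def)
  qed (use Uc U'c in auto)
  moreover have "mat_adjoint U * U = 1\<^sub>m d"
  proof (rule eq_matI)
    fix k l assume "k < dim_row (1\<^sub>m d :: complex mat)" "l < dim_col (1\<^sub>m d :: complex mat)"
    then have kl: "k < d" "l < d" by auto
    have "(mat_adjoint U * U) $$ (k, l) = ip d (x l) (x k)"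
      using Uc U'c kl by (auto simp: scalar_prod_def lessThan_atLeast0 U' Ue ip_def mult.commute intro!: sum.cong)
    then show "(mat_adjoint U * U) $$ (k, l) = 1\<^sub>m d $$ (k, l)" using onb kl by (simp add: onb_def)
  qed (use Uc U'c in auto)
  ultimately have U: "unitary_mat d U" by (simp add: unitary_mat_def Uc)
  have entry: "(U * mat_diag d (\<lambda>i. complex_of_real (g i)) * mat_adjoint U) $$ (a, b)
      = (\<Sum>k<d. complex_of_real (g k) * x k a * cnj (x k b))" if "a < d" "b < d" for g a b
    unfolding mat_diag_mult_right[OF Uc]
    using Uc U'c that by (auto simp: scalar_prod_def lessThan_atLeast0 U' Ue mult_ac intro!: sum.cong)
  have dims: "U * mat_diag d (\<lambda>i. complex_of_real (g i)) * mat_adjoint U \<in> carrier_mat d d" for g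
    unfolding mat_diag_mult_right[OF Uc] by (intro mult_carrier_mat[OF _ U'c]) simp
  have "A = U * mat_diag d (\<lambda>i. complex_of_real (e i)) * mat_adjoint U"
  proof (rule eq_matI)
    fix a b
    assume "a < dim_row (U * mat_diag d (\<lambda>i. complex_of_real (e i)) * mat_adjoint U)"
      and "b < dim_col (U * mat_diag d (\<lambda>i. complex_of_real (e i)) * mat_adjoint U)"
    then have ab: "a < d" "b < d" unfolding carrier_matD[OF dims] by auto
    show "A $$ (a, b) = (U * mat_diag d (\<lambda>i. complex_of_real (e i)) * mat_adjoint U) $$ (a, b)"
      unfolding entry[OF ab] by (rule eigdec_entry[OF A ab])
  qed (use A in \<open>unfold carrier_matD[OF dims], auto simp: eigdec_def\<close>)
  from psd_powr_eqI[OF U this]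
  show ?thesis using onb dims by (simp add: eigdec_def entry)
qed

text \<open>In the eigenbases the trace is the sum of \<open>e k powr s * f l powr (1 - s)\<close>
  weighted by the same squared inner products, and a minimum never exceeds a weighted geometric
  mean.\<close>

lemma overlap_le_trace_powr:
  assumes A: "eigdec d A x e" and B: "eigdec d B y f"
    and e: "\<And>k. k < d \<Longrightarrow> 0 \<le> e k" and f: "\<And>l. l < d \<Longrightarrow> 0 \<le> f l"
    and s: "0 \<le> s" "s \<le> 1"
  shows "overlap d e x f y \<le> Re (mat_trace (psd_powr d A s * psd_powr d B (1 - s)))"
proof -
  have A': "eigdec d (psd_powr d A s) x (\<lambda>k. e k powr s)" by (rule eigdec_psd_powr[OF A])
  have B': "eigdec d (psd_powr d B (1 - s)) y (\<lambda>k. f k powr (1 - s))" by (rule eigdec_psd_powr[OF B])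
  \<comment> \<open>If \<open>a\<close> or \<open>c\<close> is zero, both sides are zero, also for
    \<open>s = 0\<close> and \<open>s = 1\<close>, because \<open>0 powr 0 = 0\<close>; this is the
    convention of powers on the support.\<close>
  have min_le: "min a c \<le> a powr s * c powr (1 - s)" if "0 \<le> a" "0 \<le> c" for a c :: real
  proof (cases "a = 0 \<or> c = 0")
    case False
    define m where "m = min a c"
    have "0 < m" using that False by (auto simp: m_def)
    then have "m = m powr s * m powr (1 - s)" by (simp add: powr_add[symmetric])
    also have "\<dots> \<le> a powr s * c powr (1 - s)"
      using s \<open>0 < m\<close> by (intro mult_mono powr_mono2) (auto simp: m_def)
    finally show ?thesis by (simp add: m_def)
  qed (use that in auto)
  have "overlap d e x f y \<le> (\<Sum>k<d. \<Sum>l<d. e k powr s * f l powr (1 - s) * (cmod (ip d (x k) (y l)))\<^sup>2)"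
    unfolding overlap_def using e f by (intro sum_mono mult_right_mono min_le) auto
  also have "\<dots> = Re (mat_trace (psd_powr d A s * psd_powr d B (1 - s)))"
    using B' by (simp add: trace_mult_eigdec[OF A'] qform_eigdec[OF B'] eigdec_def sum_distrib_left mult.assoc)
  finally show ?thesis .
qed

lemma opt_err_pair_le_chernoff:
  assumes "psd d A" "psd d B"
  shows "opt_err d [A, B] \<le> 24 * (INF s\<in>{0..1}. Re (mat_trace (psd_powr d A s * psd_powr d B (1 - s))))"
proof -
  obtain x e where A: "eigdec d A x e" "\<forall>k<d. 0 \<le> e k" using psd_eigdec[OF assms(1)] by blast
  obtain y f where B: "eigdec d B y f" "\<forall>k<d. 0 \<le> f k" using psd_eigdec[OF assms(2)] by blast
  have "opt_err d [A, B] \<le> 24 * overlap d e x f y"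
    using A B assms by (intro opt_err_pair_le_overlap) auto
  also have "overlap d e x f y \<le> (INF s\<in>{0..1}. Re (mat_trace (psd_powr d A s * psd_powr d B (1 - s))))"
    using A B by (intro cINF_greatest overlap_le_trace_powr) auto
  finally show ?thesis by simp
qed

lemma mult_one_minus_zero:
  "A \<in> carrier_mat d d \<Longrightarrow> A * (1\<^sub>m d - 0\<^sub>m d d) = (A :: complex mat)"
proof -
  assume "A \<in> carrier_mat d d"
  moreover have "1\<^sub>m d - 0\<^sub>m d d = (1\<^sub>m d :: complex mat)" by (rule eq_matI) auto
  ultimately show ?thesis by simp
qed

lemma opt_err_le_sum_trace:
  assumes "\<And>i. i < length As \<Longrightarrow> psd d (As ! i)"
  shows "opt_err d As \<le> (\<Sum>i<length As. Re (mat_trace (As ! i)))"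
proof -
  have "As ! i * (1\<^sub>m d - 0\<^sub>m d d) = As ! i" if "i < length As" for i
    using assms[OF that] by (intro mult_one_minus_zero) (simp add: psd_def)
  then show ?thesis using opt_err_le[OF assms povm_zero] by simp
qed

lemma trace_psd_nonneg:
  assumes "psd d A"
  shows "0 \<le> Re (mat_trace A)"
proof -
  have "A * (1\<^sub>m d - 0\<^sub>m d d) = A" using assms by (intro mult_one_minus_zero) (simp add: psd_def)
  then show ?thesis using error_term_nonneg[OF assms povm_zero[of d 1], of 0] by simp
qed

lemma mat_trace_mat_sum:
  assumes "\<And>i. i \<in> I \<Longrightarrow> F i \<in> carrier_mat d d"
  shows "mat_trace (mat_sum d I F) = (\<Sum>i\<in>I. mat_trace (F i))"
proof -
  have "mat_trace (mat_sum d I F) = (\<Sum>a<d. \<Sum>i\<in>I. F i $$ (a, a))"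
    by (simp add: mat_trace_def mat_sum_def)
  also have "\<dots> = (\<Sum>i\<in>I. \<Sum>a<d. F i $$ (a, a))" by (rule sum.swap)
  also have "\<dots> = (\<Sum>i\<in>I. mat_trace (F i))"
    using assms by (intro sum.cong refl) (auto simp: mat_trace_def)
  finally show ?thesis .
qed

section \<open>Exponents\<close>

lemma exp_rate_less_iff_eventually:
  assumes "exp_rate b x < c"
  shows "eventually (\<lambda>n. ereal (1 / real n) * elog b (x n) < c) sequentially"
  using assms unfolding exp_rate_def by (rule Limsup_lessD)

lemma elog_mono:
  assumes "b > 1" "x \<le> y"
  shows "elog b x \<le> elog b y"
  using assms by (auto simp: elog_def)

text \<open>The factor adds \<open>log b K / n\<close>, which tends to zero.\<close>

lemma exp_rate_cmult_le:
  assumes b: "b > 1" and K: "K > 0"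
  shows "exp_rate b (\<lambda>n. K * y n) \<le> exp_rate b y"
  unfolding exp_rate_def[of b "\<lambda>n. K * y n"] Limsup_le_iff
proof (intro allI impI)
  fix c assume "exp_rate b y < c"
  then obtain u where u: "exp_rate b y < ereal u" "ereal u < c" using ereal_dense2 by blast
  then obtain v where v: "ereal u < ereal v" "ereal v < c" using ereal_dense2 by blast
  have "(\<lambda>n. log b K * (1 / real n)) \<longlonglongrightarrow> log b K * 0"
    by (intro tendsto_mult tendsto_const lim_1_over_n)
  then have "eventually (\<lambda>n. log b K * (1 / real n) < v - u) sequentially"
    using v(1) by (intro order_tendstoD(2)) auto
  with exp_rate_less_iff_eventually[OF u(1)] eventually_gt_at_top[of "0::nat"]
  show "eventually (\<lambda>n. ereal (1 / real n) * elog b (K * y n) < c) sequentially"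
  proof eventually_elim
    case (elim n)
    show ?case
    proof (cases "y n \<le> 0")
      case True
      then have "K * y n \<le> 0" using K by (simp add: mult_le_0_iff)
      then show ?thesis using elim True u by (auto simp: elog_def)
    next
      case False
      then have "K * y n > 0" "log b (K * y n) = log b K + log b (y n)"
        using K b by (auto simp: log_mult)
      then show ?thesis using elim False v
        by (auto simp: elog_def algebra_simps add_divide_distrib intro!: order.strict_trans[OF _ v(2)])
    qed
  qed
qed

text \<open>A finite sum is at most its number of terms times its largest term, and this number
  joins the constant. The largest term may change with \<open>n\<close>, so all terms are brought
  below \<open>c\<close> simultaneously.\<close>

lemma exp_rate_le_Max:
  assumes b: "b > 1" and K: "K > 0" and S: "finite S" "S \<noteq> {}"
    and le: "\<And>n. n \<ge> 1 \<Longrightarrow> x n \<le> K * (\<Sum>p\<in>S. y p n)"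
  shows "exp_rate b x \<le> Max ((\<lambda>p. exp_rate b (y p)) ` S)"
  unfolding exp_rate_def[of b x] Limsup_le_iff
proof (intro allI impI)
  fix c assume c: "Max ((\<lambda>p. exp_rate b (y p)) ` S) < c"
  define K' where "K' = K * real (card S)"
  have K': "K' > 0" using K S by (simp add: K'_def card_gt_0_iff)
  have "\<forall>p\<in>S. eventually (\<lambda>n. ereal (1 / real n) * elog b (K' * y p n) < c) sequentially"
  proof
    fix p assume p: "p \<in> S"
    have "exp_rate b (\<lambda>n. K' * y p n) \<le> exp_rate b (y p)" by (rule exp_rate_cmult_le[OF b K'])
    also have "\<dots> \<le> Max ((\<lambda>p. exp_rate b (y p)) ` S)" using S p by simp
    also note c
    finally show "eventually (\<lambda>n. ereal (1 / real n) * elog b (K' * y p n) < c) sequentially"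
      by (rule exp_rate_less_iff_eventually)
  qed
  then have "eventually (\<lambda>n. \<forall>p\<in>S. ereal (1 / real n) * elog b (K' * y p n) < c) sequentially"
    using S(1) by (simp add: eventually_ball_finite)
  with eventually_gt_at_top[of "0::nat"]
  show "eventually (\<lambda>n. ereal (1 / real n) * elog b (x n) < c) sequentially"
  proof eventually_elim
    case (elim n)
    define m where "m = Max ((\<lambda>p. y p n) ` S)"
    have "m \<in> (\<lambda>p. y p n) ` S" unfolding m_def using S by (intro Max_in) auto
    then obtain p where p: "p \<in> S" "m = y p n" by blast
    have "(\<Sum>p\<in>S. y p n) \<le> real (card S) * m"
      using S by (intro sum_bounded_above) (auto simp: m_def)
    then have "K * (\<Sum>p\<in>S. y p n) \<le> K' * y p n"
      using K p by (simp add: K'_def mult.assoc)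
    then have "x n \<le> K' * y p n" using le[of n] elim(1) by simp
    then have "ereal (1 / real n) * elog b (x n) \<le> ereal (1 / real n) * elog b (K' * y p n)"
      using b by (intro ereal_mult_left_mono elog_mono) auto
    then show ?case using elim(2) p(1) by (meson le_less_trans)
  qed
qed

lemma exp_rate_mono_cmult:
  assumes "b > 1" "K > 0" "\<And>n. n \<ge> 1 \<Longrightarrow> x n \<le> K * y n"
  shows "exp_rate b x \<le> exp_rate b y"
  using exp_rate_le_Max[of b K "{()}" x "\<lambda>_. y"] assms by simp

text \<open>Passes from a full to a halved exponent once it is known to be nonpositive; the value
  \<open>-\<infinity>\<close> is included.\<close>

lemma ereal_le_half: "x \<le> 0 \<Longrightarrow> x \<le> ereal (1/2) * x"
  by (cases x) auto

lemma finite_pairs: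
  "finite I \<Longrightarrow> finite {f i j | i j. i \<in> I \<and> j \<in> I \<and> Q i j}"
  by (rule finite_subset[of _ "(\<lambda>(i, j). f i j) ` (I \<times> I)"]) auto

section \<open>Inequalities between the error exponents and the Chernoff divergences\<close>

theorem theorem7p5:
  fixes r :: nat
    and b :: real
    and d :: "nat \<Rightarrow> nat"
    and A :: "nat \<Rightarrow> nat \<Rightarrow> complex mat"
  assumes "r \<ge> 2"
    and "b > 1"
    and "\<And>n i. n \<ge> 1 \<Longrightarrow> i \<in> {1..r} \<Longrightarrow> psd (d n) (A i n)"
    and "\<And>n i. n \<ge> 1 \<Longrightarrow> i \<in> {1..r} \<Longrightarrow> A i n \<noteq> 0\<^sub>m (d n) (d n)"
    and "exp_rate b (\<lambda>n. Re (mat_trace (mat_sum (d n) {1..r} (\<lambda>i. A i n)))) = 0"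
  shows
    "(\<forall>k\<in>{1..r}. \<forall>l\<in>{1..r}. k \<noteq> l \<longrightarrow>
        err_exponent b d (map A [1..<r+1])
          \<le> Max ({err_exponent b d [A k, A l]} \<union>
                 {ereal (1/2) * err_exponent b d [A i, A j] | i j.
                    i \<in> {1..r} \<and> j \<in> {1..r} \<and> i \<noteq> j \<and> {i, j} \<noteq> {k, l}})
      \<and> Max ({err_exponent b d [A k, A l]} \<union>
                 {ereal (1/2) * err_exponent b d [A i, A j] | i j.
                    i \<in> {1..r} \<and> j \<in> {1..r} \<and> i \<noteq> j \<and> {i, j} \<noteq> {k, l}})
          \<le> - Min ({chernoff b d (A k) (A l)} \<union>
                 {ereal (1/2) * chernoff b d (A i) (A j) | i j.
                    i \<in> {1..r} \<and> j \<in> {1..r} \<and> i \<noteq> j \<and> {i, j} \<noteq> {k, l}}))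
   \<and> ((\<exists>k\<in>{1..r}. \<exists>l\<in>{1..r}. k \<noteq> l \<and>
          ((\<forall>i\<in>{1..r}. \<forall>j\<in>{1..r}. i \<noteq> j \<and> {i, j} \<noteq> {k, l} \<longrightarrow>
              err_exponent b d [A k, A l] \<ge> ereal (1/2) * err_exponent b d [A i, A j])
           \<or> (\<forall>i\<in>{1..r}. \<forall>j\<in>{1..r}. i \<noteq> j \<and> {i, j} \<noteq> {k, l} \<longrightarrow>
              chernoff b d (A k) (A l) \<le> ereal (1/2) * chernoff b d (A i) (A j))))
      \<longrightarrow>
        err_exponent b d (map A [1..<r+1])
          \<le> Max {err_exponent b d [A i, A j] | i j. i \<in> {1..r} \<and> j \<in> {1..r} \<and> i \<noteq> j}
      \<and> Max {err_exponent b d [A i, A j] | i j. i \<in> {1..r} \<and> j \<in> {1..r} \<and> i \<noteq> j}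
          \<le> - Min {chernoff b d (A i) (A j) | i j. i \<in> {1..r} \<and> j \<in> {1..r} \<and> i \<noteq> j})"
proof -
  define p where "p i j = err_exponent b d [A i, A j]" for i j
  define q where "q i j = chernoff b d (A i) (A j)" for i j
  have p: "p i j = exp_rate b (\<lambda>n. opt_err (d n) [A i n, A j n])" for i j
    by (simp add: p_def err_exponent_def)
  note b = \<open>b > 1\<close> and psd = assms(3)
  have pq: "p i j \<le> - q i j" if "i \<in> {1..r}" "j \<in> {1..r}" for i j
    unfolding p q_def chernoff_def ereal_uminus_uminus
    using that psd by (intro exp_rate_mono_cmult[OF b, of 24] opt_err_pair_le_chernoff) auto
  \<comment> \<open>The condition \<open>{i, j} = {k, l}\<close> also admits the swapped pair, whose
    exponent has to be compared with \<open>p k l\<close>.\<close>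
  have p_commute: "p j i \<le> p i j" if "i \<in> {1..r}" "j \<in> {1..r}" for i j
    unfolding p using that psd by (intro exp_rate_mono_cmult[OF b, of 48] opt_err_pair_commute_le) auto
  \<comment> \<open>The trace condition enters here: the error of a pair is at most the sum of its
    two traces, hence at most the trace of the sum of all operators, whose rate is zero.\<close>
  have p0: "p i j \<le> 0" if ij: "i \<in> {1..r}" "j \<in> {1..r}" "i \<noteq> j" for i j
  proof -
    have "opt_err (d n) [A i n, A j n] \<le> 1 * Re (mat_trace (mat_sum (d n) {1..r} (\<lambda>i. A i n)))"
      if n: "n \<ge> 1" for n
    proof -
      have "opt_err (d n) [A i n, A j n] \<le> (\<Sum>k<length [A i n, A j n]. Re (mat_trace ([A i n, A j n] ! k)))"
        using psd[OF n] ij by (intro opt_err_le_sum_trace) (auto simp: less_Suc_eq)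
      also have "\<dots> = (\<Sum>k\<in>{i, j}. Re (mat_trace (A k n)))" using ij by simp
      also have "\<dots> \<le> (\<Sum>k\<in>{1..r}. Re (mat_trace (A k n)))"
        using psd[OF n] ij by (intro sum_mono2) (auto intro: trace_psd_nonneg)
      also have "\<dots> = Re (mat_trace (mat_sum (d n) {1..r} (\<lambda>i. A i n)))"
        using psd[OF n] by (subst mat_trace_mat_sum) (auto simp: psd_def)
      finally show ?thesis by simp
    qed
    then have "p i j \<le> exp_rate b (\<lambda>n. Re (mat_trace (mat_sum (d n) {1..r} (\<lambda>i. A i n))))"
      unfolding p by (intro exp_rate_mono_cmult[OF b, of 1]) auto
    then show ?thesis using assms(5) by simp
  qed
  \<comment> \<open>Any common bound of the pairwise exponents bounds the exponent of all
    hypotheses; \<open>m\<close> will be each of the two maxima.\<close>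
  have all: "err_exponent b d (map A [1..<r+1]) \<le> m"
    if m: "\<And>i j. i \<in> {1..r} \<Longrightarrow> j \<in> {1..r} \<Longrightarrow> i \<noteq> j \<Longrightarrow> p i j \<le> m" for m
  proof -
    \<comment> \<open>List positions run from 0, hypotheses from 1: position \<open>i\<close> holds
      \<open>A (i + 1)\<close>.\<close>
    define S where "S = Sigma {..<r} (\<lambda>i. {..<r} - {i})"
    define y where "y ij n = opt_err (d n) [A (fst ij + 1) n, A (snd ij + 1) n]" for ij n
    have S: "finite S" "S \<noteq> {}"
    proof -
      have "(0, 1) \<in> S" using \<open>r \<ge> 2\<close> by (auto simp: S_def)
      then show "S \<noteq> {}" by blast
    qed (simp add: S_def)
    have le: "opt_err (d n) (map (\<lambda>X. X n) (map A [1..<r+1])) \<le> 8 * (real r + 1) * (\<Sum>ij\<in>S. y ij n)"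
      if n: "n \<ge> 1" for n
    proof -
      define As where "As = map (\<lambda>X. X n) (map A [1..<r+1])"
      have As: "length As = r" "\<And>i. i < r \<Longrightarrow> As ! i = A (i + 1) n" by (auto simp: As_def simp del: upt_Suc)
      have "opt_err (d n) As \<le> 8 * (real (length As) + 1) *
          (\<Sum>i<length As. \<Sum>j\<in>{..<length As} - {i}. opt_err (d n) [As ! i, As ! j])"
        using psd[OF n] \<open>r \<ge> 2\<close> by (intro opt_err_le_pairs) (auto simp: As)
      also have "(\<Sum>i<length As. \<Sum>j\<in>{..<length As} - {i}. opt_err (d n) [As ! i, As ! j]) = (\<Sum>ij\<in>S. y ij n)"
      proof -
        have "(\<Sum>ij\<in>S. y ij n) = (\<Sum>i<r. \<Sum>j\<in>{..<r} - {i}. y (i, j) n)"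
          unfolding S_def using sum.Sigma[of "{..<r}" "\<lambda>i. {..<r} - {i}" "\<lambda>i j. y (i, j) n"] by simp
        then show ?thesis by (simp add: As y_def)
      qed
      finally show ?thesis unfolding As(1) unfolding As_def .
    qed
    have "err_exponent b d (map A [1..<r+1]) \<le> Max ((\<lambda>ij. exp_rate b (y ij)) ` S)"
      unfolding err_exponent_def by (rule exp_rate_le_Max[OF b _ S le]) simp_all
    also have "\<dots> \<le> m"
    proof -
      have "exp_rate b (y ij) \<le> m" if "ij \<in> S" for ij
        using that unfolding S_def y_def p[symmetric] by (intro m) auto
      then show ?thesis using S by simp
    qed
    finally show ?thesis .
  qed
  have part1: "err_exponent b d (map A [1..<r+1])
          \<le> Max ({p k l} \<union> {ereal (1/2) * p i j | i j.
                    i \<in> {1..r} \<and> j \<in> {1..r} \<and> i \<noteq> j \<and> {i, j} \<noteq> {k, l}})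
      \<and> Max ({p k l} \<union> {ereal (1/2) * p i j | i j.
                    i \<in> {1..r} \<and> j \<in> {1..r} \<and> i \<noteq> j \<and> {i, j} \<noteq> {k, l}})
          \<le> - Min ({q k l} \<union> {ereal (1/2) * q i j | i j.
                    i \<in> {1..r} \<and> j \<in> {1..r} \<and> i \<noteq> j \<and> {i, j} \<noteq> {k, l}})"
    (is "_ \<le> Max ?P \<and> _ \<le> - Min ?Q")
    if kl: "k \<in> {1..r}" "l \<in> {1..r}" "k \<noteq> l" for k l
  proof
    have finP: "finite ?P" and finQ: "finite ?Q" using finite_pairs[of "{1..r}"] by auto
    show "err_exponent b d (map A [1..<r+1]) \<le> Max ?P"
    proof (rule all)
      fix i j assume ij: "i \<in> {1..r}" "j \<in> {1..r}" "i \<noteq> j"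
      show "p i j \<le> Max ?P"
      proof (cases "{i, j} = {k, l}")
        case True
        then have "p i j \<le> p k l" using p_commute[OF kl(1,2)] by (auto simp: doubleton_eq_iff)
        also have "\<dots> \<le> Max ?P" using finP by (intro Max_ge) auto
        finally show ?thesis .
      next
        case False
        have "p i j \<le> ereal (1/2) * p i j" using p0[OF ij] by (rule ereal_le_half)
        also have "\<dots> \<le> Max ?P" using finP ij False by (intro Max_ge) auto
        finally show ?thesis .
      qed
    qed
    \<comment> \<open>Each member of \<open>?P\<close> is at most the negative of the member of
      \<open>?Q\<close> for the same pair, by \<open>pq\<close>.\<close>
    show "Max ?P \<le> - Min ?Q"
    proof -
      have "z \<le> - Min ?Q" if z: "z \<in> ?P" for z
      proof -
        have "\<exists>c\<in>?Q. z \<le> - c"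
        proof -
          consider "z = p k l" | i j where "z = ereal (1/2) * p i j" "i \<in> {1..r}" "j \<in> {1..r}" "i \<noteq> j" "{i, j} \<noteq> {k, l}"
            using z by blast
          then show ?thesis
          proof cases
            case 1
            then show ?thesis using pq[OF kl(1,2)] by auto
          next
            case 2
            have "z \<le> ereal (1/2) * (- q i j)"
              unfolding 2(1) using pq[OF 2(2,3)] by (intro ereal_mult_left_mono) auto
            then have "z \<le> - (ereal (1/2) * q i j)" by simp
            then show ?thesis using 2 by blast
          qed
        qed
        then obtain c where c: "c \<in> ?Q" "z \<le> - c" by blast
        have "Min ?Q \<le> c" using finQ c(1) by (rule Min_le)
        then have "- c \<le> - Min ?Q" by simp
        then show ?thesis using c(2) by (rule order.trans[rotated])
      qed
      then show ?thesis using finP by (subst Max_le_iff) auto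
    qed
  qed
  \<comment> \<open>Here the full pairwise maximum serves as the bound \<open>m\<close>, and the
    second inequality is \<open>pq\<close> applied to each pair.\<close>
  have part2: "err_exponent b d (map A [1..<r+1])
          \<le> Max {p i j | i j. i \<in> {1..r} \<and> j \<in> {1..r} \<and> i \<noteq> j}
      \<and> Max {p i j | i j. i \<in> {1..r} \<and> j \<in> {1..r} \<and> i \<noteq> j}
          \<le> - Min {q i j | i j. i \<in> {1..r} \<and> j \<in> {1..r} \<and> i \<noteq> j}"
    (is "_ \<le> Max ?P \<and> _ \<le> - Min ?Q")
  proof
    have finP: "finite ?P" and finQ: "finite ?Q" using finite_pairs[of "{1..r}"] by auto
    show "err_exponent b d (map A [1..<r+1]) \<le> Max ?P"
      using finP by (intro all Max_ge) auto
    have "1 \<in> {1..r}" "2 \<in> {1..r}" "(1::nat) \<noteq> 2" using \<open>r \<ge> 2\<close> by auto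
    then have "?P \<noteq> {}" by blast
    moreover have "z \<le> - Min ?Q" if z: "z \<in> ?P" for z
    proof -
      obtain i j where ij: "z = p i j" "i \<in> {1..r}" "j \<in> {1..r}" "i \<noteq> j" using z by blast
      then have "Min ?Q \<le> q i j" using finQ by (intro Min_le) auto
      then have "- q i j \<le> - Min ?Q" by simp
      then show ?thesis using pq[OF ij(2,3)] unfolding ij(1) by (rule order.trans[rotated])
    qed
    ultimately show "Max ?P \<le> - Min ?Q" using finP by (subst Max_le_iff) auto
  qed
  show ?thesis
    using part1 part2 unfolding p_def q_def by blast
qed

end
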